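(* Let $0<p_0\le1$ and let $\Lambda,\Pi\subseteq\mathbb{R}^d$ be relatively separated. Suppose that $A\in\mathcal{C}^{p_0}(\Lambda,\Pi)$ is invertible from $\ell^p(\Pi)$ to $\ell^p(\Lambda)$ for some $p\in[p_0,\infty]$. Then $A^{-1}\in\mathcal{C}^{p_0}(\Pi,\Lambda)$.
   Context: $B_1(x)$ is the ball of radius $1$ centred at $x$. A set $\Lambda\subseteq\mathbb{R}^d$ is relatively separated if $\sup_{x\in\mathbb{R}^d}\#(\Lambda\cap B_1(x))<\infty$. $C_b(\mathbb{R}^d)$ is the space of bounded continuous functions, and $W(C_b,L^{p_0})$ is the Wiener amalgam space of all $f\in C_b(\mathbb{R}^d)$ with $\left(\int_{\mathbb{R}^d}\|f\|_{L^\infty(B_1(x))}^{p_0}\,dx\right)^{1/p_0}<\infty$. $\mathcal{C}^{p_0}(\Lambda,\Pi)$ is the set of all complex matrices $A=(a_{\lambda,\rho})_{\lambda\in\Lambda,\rho\in\Pi}$ for which there is an envelope $H\in W(C_b,L^{p_0})$ with $|a_{\lambda,\rho}|\le H(\lambda-\rho)$ for all $\lambda\in\Lambda$, $\rho\in\Pi$. Matrices are identified with operators via $(Ac)_\lambda=\sum_{\rho\in\Pi}a_{\lambda,\rho}c_\rho$; each $A\in\mathcal{C}^{p_0}(\Lambda,\Pi)$ is bounded from $\ell^q(\Pi)$ to $\ell^q(\Lambda)$ for all $q\in[p_0,\infty]$. The conclusion means that the inverse operator is given by a matrix indexed by $\Pi\times\Lambda$ that belongs to $\mathcal{C}^{p_0}(\Pi,\Lambda)$.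 *)

theory Defs
  imports "HOL-Probability.Probability"
begin

definition relatively_separated :: "'a::euclidean_space set \<Rightarrow> bool" where
  "relatively_separated \<Lambda> \<longleftrightarrow>
     (\<exists>N::nat. \<forall>x. finite (\<Lambda> \<inter> ball x 1) \<and> card (\<Lambda> \<inter> ball x 1) \<le> N)"

text \<open>The \<open>L\<^sup>\<infinity>\<close> norm on the unit ball around \<open>x\<close>, a value in \<open>[0, \<infinity>]\<close>.\<close>

definition local_Linf_norm :: "('a::euclidean_space \<Rightarrow> real) \<Rightarrow> 'a \<Rightarrow> ennreal" where
  "local_Linf_norm f x = esssup (restrict_space lborel (ball x 1)) (\<lambda>y. ennreal (norm (f y)))"

text \<open>
  The real-valued members of the Wiener amalgam space \<open>W(C\<^sub>b, L\<^sup>p)\<close>; complex-valued \<open>H\<close> would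
  yield the same class of matrices below, by passing to the modulus. Members are bounded, so
  \<^const>\<open>enn2real\<close> loses nothing, and the outer \<open>p\<close>-th root is omitted as it does not affect
  finiteness.
\<close>

definition wiener_amalgam :: "real \<Rightarrow> ('a::euclidean_space \<Rightarrow> real) set" where
  "wiener_amalgam p =
     {f \<in> bcontfun. (\<integral>\<^sup>+ x. ennreal (enn2real (local_Linf_norm f x) powr p) \<partial>lborel) < \<infinity>}"

text \<open>
  A matrix indexed by \<open>\<Lambda> \<times> \<Gamma>\<close> is represented by a total function, of which only the values on
  \<open>\<Lambda> \<times> \<Gamma>\<close> are ever used.
\<close>

definition conv_dominated ::
  "real \<Rightarrow> 'a::euclidean_space set \<Rightarrow> 'a set \<Rightarrow> ('a \<Rightarrow> 'a \<Rightarrow> complex) set" where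
  "conv_dominated p \<Lambda> \<Gamma> =
     {A. \<exists>H \<in> wiener_amalgam p. \<forall>l\<in>\<Lambda>. \<forall>r\<in>\<Gamma>. norm (A l r) \<le> H (l - r)}"

text \<open>
  Sequences indexed by \<open>I\<close> are represented by functions vanishing outside \<open>I\<close>. The exponent is
  meant to satisfy \<open>0 < p \<le> \<infinity>\<close>; for \<open>p < 1\<close>, \<open>lp_norm p\<close> is only a quasi-norm.
\<close>

definition lp_space :: "ennreal \<Rightarrow> 'i set \<Rightarrow> ('i \<Rightarrow> complex) set" where
  "lp_space p I = {c. (\<forall>i. i \<notin> I \<longrightarrow> c i = 0) \<and>
     (if p = \<infinity> then bounded (range c)
      else (\<lambda>i. norm (c i) powr enn2real p) summable_on UNIV)}"

definition lp_norm :: "ennreal \<Rightarrow> ('i \<Rightarrow> complex) \<Rightarrow> real" where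
  "lp_norm p c =
     (if p = \<infinity> then (SUP i. norm (c i))
      else (\<Sum>\<^sub>\<infinity>i. norm (c i) powr enn2real p) powr (1 / enn2real p))"

definition lp_bounded_operator ::
  "ennreal \<Rightarrow> 'i set \<Rightarrow> 'j set \<Rightarrow> (('i \<Rightarrow> complex) \<Rightarrow> ('j \<Rightarrow> complex)) \<Rightarrow> bool" where
  "lp_bounded_operator p I J T \<longleftrightarrow>
     (\<forall>c\<in>lp_space p I. T c \<in> lp_space p J) \<and>
     (\<forall>c\<in>lp_space p I. \<forall>d\<in>lp_space p I. T (\<lambda>i. c i + d i) = (\<lambda>j. T c j + T d j)) \<and>
     (\<forall>z. \<forall>c\<in>lp_space p I. T (\<lambda>i. z * c i) = (\<lambda>j. z * T c j)) \<and>
     (\<exists>K. \<forall>c\<in>lp_space p I. lp_norm p (T c) \<le> K * lp_norm p c)"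

definition lp_inverse_operators ::
  "ennreal \<Rightarrow> 'i set \<Rightarrow> 'j set \<Rightarrow> (('i \<Rightarrow> complex) \<Rightarrow> ('j \<Rightarrow> complex)) \<Rightarrow>
    (('j \<Rightarrow> complex) \<Rightarrow> ('i \<Rightarrow> complex)) \<Rightarrow> bool" where
  "lp_inverse_operators p I J T S \<longleftrightarrow>
     lp_bounded_operator p I J T \<and> lp_bounded_operator p J I S \<and>
     (\<forall>c\<in>lp_space p I. S (T c) = c) \<and> (\<forall>d\<in>lp_space p J. T (S d) = d)"

definition lp_invertible ::
  "ennreal \<Rightarrow> 'i set \<Rightarrow> 'j set \<Rightarrow> (('i \<Rightarrow> complex) \<Rightarrow> ('j \<Rightarrow> complex)) \<Rightarrow> bool" where
  "lp_invertible p I J T \<longleftrightarrow> (\<exists>S. lp_inverse_operators p I J T S)"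

text \<open>
  For \<open>A \<in> conv_dominated p0 \<Lambda> \<Gamma>\<close> (with \<open>\<Lambda>\<close>, \<open>\<Gamma>\<close> relatively separated and \<open>p0 \<le> 1\<close>) and
  \<open>c \<in> lp_space q \<Gamma>\<close> with \<open>p0 \<le> q\<close> the sum converges absolutely, so the default value of
  \<^const>\<open>infsum\<close> for divergent sums plays no role.
\<close>

definition matrix_operator ::
  "'i set \<Rightarrow> 'j set \<Rightarrow> ('i \<Rightarrow> 'j \<Rightarrow> complex) \<Rightarrow> ('j \<Rightarrow> complex) \<Rightarrow> ('i \<Rightarrow> complex)" where
  "matrix_operator \<Lambda> \<Gamma> A c = (\<lambda>l. if l \<in> \<Lambda> then \<Sum>\<^sub>\<infinity>r\<in>\<Gamma>. A l r * c r else 0)"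

end

theory Submission
  imports Defs
begin

text \<open>
  The proof is Sjostrand's localization method. It reads off-diagonal decay of
  the inverse directly from its boundedness on the given \<open>\<ell>\<^sup>p\<close>, in the same way for all \<open>p \<ge> p0\<close>.
  Throughout \<open>t = min 1 p\<close>, since it is \<open>\<parallel>c\<parallel>\<^sub>p\<^sup>t\<close> that satisfies the triangle inequality.

  Cover \<open>\<real>\<^sup>d\<close> by Lipschitz windows \<open>\<phi>\<^sub>k\<close> of width \<open>R\<close>, centred at the points \<open>R k\<close> of a scaled
  integer lattice, and set \<open>N c k = \<parallel>\<phi>\<^sub>k c\<parallel>\<^sub>p\<^sup>t\<close>. Invertibility bounds \<open>\<phi>\<^sub>k c\<close> by
  \<open>A \<phi>\<^sub>k c = \<phi>\<^sub>k A c + [A, \<phi>\<^sub>k] c\<close>. The commutator has the entries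
  \<open>A\<^sub>l\<^sub>r (\<phi>\<^sub>k r - \<phi>\<^sub>k l)\<close>, which the gain \<open>min 1 (\<bar>l - r\<bar> / R)\<close> makes small when \<open>R\<close> is large.
  Hence
  \<open>N c k \<le> C (N (A c) k + \<Sum>\<^sub>j U (k - j)\<^sup>t\<^sup>/\<^sup>p\<^sup>0 N c j)\<close>,
  where \<open>\<Sum>\<^sub>n U n\<close> tends to \<open>0\<close> as \<open>R \<rightarrow> \<infinity>\<close> (\<open>commutator_kernel\<close>, \<open>localized_estimate\<close>; the
  block form \<open>block_schur\<close> of Schur's test passes from entries to norms).

  Iterating this inequality in \<open>\<ell>\<^sup>s\<close> of the lattice, \<open>s = p0 / t \<le> 1\<close>, gives a majorant
  \<open>W \<in> \<ell>\<^sup>s\<close> that, up to a translation, does not depend on \<open>l\<close> when \<open>A c = e\<^sub>l\<close> (\<open>convolution_majorant\<close>). Indeed, the source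
  \<open>e\<^sub>l\<close> lives in the windows next to \<open>l\<close>, so that
  \<open>\<bar>(A\<^sup>-\<^sup>1 e\<^sub>l) r\<bar>\<^sup>t \<le> W (k - j)\<close> for the cells \<open>k\<close>, \<open>j\<close> of \<open>r\<close> and \<open>l\<close>; interpolating \<open>W\<^sup>1\<^sup>/\<^sup>t\<close> by
  bumps produces an envelope (\<open>inverse_columns_dominated\<close>, \<open>lattice_envelope\<close>).

  So the matrix \<open>B\<close> with columns \<open>A\<^sup>-\<^sup>1 e\<^sub>l\<close> is convolution dominated. Unit sequences do not span
  a dense subspace of \<open>\<ell>\<^sup>\<infinity>\<close>, which rules out an appeal to continuity. Instead, \<open>B d \<in> \<ell>\<^sup>p\<close> by Schur's test and
  \<open>A (B d) = (A B) d = d\<close> by absolute convergence; applying \<open>A\<^sup>-\<^sup>1\<close> gives \<open>B d = A\<^sup>-\<^sup>1 d\<close>.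
\<close>

section \<open>Powers of finite sums\<close>

lemma sum_powr_le_powr_sum:
  fixes y :: "'i \<Rightarrow> real"
  assumes F: "finite F" and y: "\<And>i. i \<in> F \<Longrightarrow> 0 \<le> y i" and s: "1 \<le> s"
  shows "(\<Sum>i\<in>F. y i powr s) \<le> (\<Sum>i\<in>F. y i) powr s"
proof -
  let ?Y = "\<Sum>i\<in>F. y i"
  have powr_split: "a powr s = a * a powr (s - 1)" if "0 \<le> a" for a :: real
    using that powr_mult_base[of a "s - 1"] by simp
  have "(\<Sum>i\<in>F. y i powr s) = (\<Sum>i\<in>F. y i * y i powr (s - 1))"
    using y powr_split by (intro sum.cong) auto
  also have "\<dots> \<le> (\<Sum>i\<in>F. y i * ?Y powr (s - 1))"
    using y s F by (intro sum_mono mult_left_mono powr_mono2 member_le_sum) auto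
  also have "\<dots> = ?Y * ?Y powr (s - 1)"
    by (simp add: sum_distrib_right)
  also have "\<dots> = ?Y powr s"
    using powr_split[of ?Y] y by (simp add: sum_nonneg)
  finally show ?thesis .
qed

lemma powr_sum_le_sum_powr:
  fixes y :: "'i \<Rightarrow> real"
  assumes F: "finite F" and y: "\<And>i. i \<in> F \<Longrightarrow> 0 \<le> y i" and s: "0 < s" "s \<le> 1"
  shows "(\<Sum>i\<in>F. y i) powr s \<le> (\<Sum>i\<in>F. y i powr s)"
proof -
  have "(\<Sum>i\<in>F. y i) = (\<Sum>i\<in>F. (y i powr s) powr (1 / s))"
    using y s by (intro sum.cong) (auto simp: powr_powr)
  also have "\<dots> \<le> (\<Sum>i\<in>F. y i powr s) powr (1 / s)"
    using s F by (intro sum_powr_le_powr_sum) auto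
  finally have "(\<Sum>i\<in>F. y i) powr s \<le> ((\<Sum>i\<in>F. y i powr s) powr (1 / s)) powr s"
    using s y by (intro powr_mono2) (auto simp: sum_nonneg)
  also have "\<dots> = (\<Sum>i\<in>F. y i powr s)"
    using s by (simp add: powr_powr sum_nonneg)
  finally show ?thesis .
qed

text \<open>
  Jensen's inequality for \<open>t \<mapsto> t powr p\<close> with unnormalized weights. Indices with a
  vanishing weight or value contribute to neither side of the convexity inequality and are discarded
  first, so that the function is only considered on the open half-line.
\<close>

lemma weighted_power_mean:
  fixes w x :: "'i \<Rightarrow> real"
  assumes F: "finite F" and w: "\<And>i. i \<in> F \<Longrightarrow> 0 \<le> w i" and x: "\<And>i. i \<in> F \<Longrightarrow> 0 \<le> x i"
    and p: "1 \<le> p"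
  shows "(\<Sum>i\<in>F. w i * x i) powr p \<le> (\<Sum>i\<in>F. w i) powr (p - 1) * (\<Sum>i\<in>F. w i * x i powr p)"
proof -
  define P where "P = {i\<in>F. 0 < w i \<and> 0 < x i}"
  have P: "finite P" "P \<subseteq> F" using F by (auto simp: P_def)
  have restrict: "(\<Sum>i\<in>F. w i * h (x i)) = (\<Sum>i\<in>P. w i * h (x i))" if "h 0 = 0" for h :: "real \<Rightarrow> real"
    using F that w x by (intro sum.mono_neutral_right) (auto simp: P_def less_le)
  show ?thesis
  proof (cases "P = {}")
    case True
    then have "(\<Sum>i\<in>F. w i * x i) = 0" using restrict[of "\<lambda>t. t"] by simp
    then show ?thesis using w by (auto intro!: mult_nonneg_nonneg sum_nonneg)
  next
    case False
    define W where "W = (\<Sum>i\<in>P. w i)"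
    have W: "0 < W" unfolding W_def using P False by (intro sum_pos) (auto simp: P_def)
    have WF: "W \<le> (\<Sum>i\<in>F. w i)" unfolding W_def using P F w by (intro sum_mono2) auto
    have "(\<Sum>i\<in>P. (w i / W) *\<^sub>R x i) powr p \<le> (\<Sum>i\<in>P. w i / W * x i powr p)"
      using P False W
      by (intro convex_on_sum[OF _ _ powr_convex[OF p]])
         (auto simp: P_def sum_divide_distrib[symmetric] W_def[unfolded P_def, symmetric])
    then have *: "((\<Sum>i\<in>P. w i * x i) / W) powr p \<le> (\<Sum>i\<in>P. w i * x i powr p) / W"
      by (simp add: sum_divide_distrib)
    have nonneg: "0 \<le> (\<Sum>i\<in>P. w i * x i)" by (auto intro!: sum_nonneg simp: P_def)
    have "(\<Sum>i\<in>P. w i * x i) powr p = W powr p * ((\<Sum>i\<in>P. w i * x i) / W) powr p"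
      using W nonneg by (simp add: powr_divide)
    also have "\<dots> \<le> W powr p * ((\<Sum>i\<in>P. w i * x i powr p) / W)"
      using * by (intro mult_left_mono) auto
    also have "\<dots> = W powr (p - 1) * (\<Sum>i\<in>P. w i * x i powr p)"
      using W by (simp add: powr_diff)
    also have "\<dots> \<le> (\<Sum>i\<in>F. w i) powr (p - 1) * (\<Sum>i\<in>P. w i * x i powr p)"
      using W WF p by (intro mult_right_mono powr_mono2 sum_nonneg) (auto simp: P_def)
    finally show ?thesis
      using restrict[of "\<lambda>t. t"] restrict[of "\<lambda>t. t powr p"] by simp
  qed
qed

text \<open>
  The embedding \<open>\<ell>\<^sup>q \<subseteq> \<ell>\<^sup>r\<close>. It converts envelopes, which control \<open>q\<close>-th powers, into the
  \<open>r\<close>-th powers that Schur's test on \<open>\<ell>\<^sup>p\<close> asks for.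
\<close>

lemma sum_powr_exponent_mono:
  fixes y :: "'i \<Rightarrow> real"
  assumes "finite F" "\<And>i. i \<in> F \<Longrightarrow> 0 \<le> y i" "0 < q" "q \<le> r" "(\<Sum>i\<in>F. y i powr q) \<le> C"
  shows "(\<Sum>i\<in>F. y i powr r) \<le> C powr (r / q)"
proof -
  have "(\<Sum>i\<in>F. y i powr r) = (\<Sum>i\<in>F. (y i powr q) powr (r / q))"
    using assms by (simp add: powr_powr)
  also have "\<dots> \<le> (\<Sum>i\<in>F. y i powr q) powr (r / q)"
    using assms by (intro sum_powr_le_powr_sum) auto
  also have "\<dots> \<le> C powr (r / q)"
    using assms by (intro powr_mono2) (auto simp: sum_nonneg)
  finally show ?thesis .
qed

section \<open>Sequence spaces through bounds on finite sums\<close>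

text \<open>
  The largest exponent \<open>r \<le> 1\<close> for which \<open>\<parallel>c\<parallel>\<^sub>p\<^sup>r\<close> is subadditive.
\<close>

definition subadd_exp :: "ennreal \<Rightarrow> real" where
  "subadd_exp p = (if p = \<infinity> then 1 else min 1 (enn2real p))"

text \<open>
  The bound \<open>\<parallel>x\<parallel>\<^sub>p\<^sup>r \<le> t\<close> for a nonnegative \<open>x\<close>, with \<open>r = subadd_exp p\<close>. Stating it through finite
  partial sums frees it from summability conditions; the exponent \<open>p / r\<close> turns a bound on the
  \<open>r\<close>-th power of the norm into one on the sum of \<open>p\<close>-th powers.
\<close>

definition lp_le :: "ennreal \<Rightarrow> 'i set \<Rightarrow> ('i \<Rightarrow> real) \<Rightarrow> real \<Rightarrow> bool" where
  "lp_le p I x t \<longleftrightarrow> (if p = \<infinity> then \<forall>i\<in>I. x i \<le> t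
     else \<forall>F. finite F \<longrightarrow> F \<subseteq> I \<longrightarrow>
       (\<Sum>i\<in>F. x i powr enn2real p) \<le> t powr (enn2real p / subadd_exp p))"

lemma subadd_exp_pos: "0 < p \<Longrightarrow> 0 < subadd_exp p"
  by (auto simp: subadd_exp_def enn2real_positive_iff less_top)

lemma subadd_exp_ge:
  assumes q: "0 < q" "q \<le> 1" "ennreal q \<le> p"
  shows "0 < p" "q \<le> subadd_exp p"
proof -
  have "0 < ennreal q" using q by simp
  then show "0 < p" using q(3) by (rule order.strict_trans2)
  show "q \<le> subadd_exp p"
  proof (cases "p = \<infinity>")
    case False
    then have "q \<le> enn2real p" using q enn2real_mono[of "ennreal q" p] by (simp add: less_top)
    then show ?thesis using q by (simp add: subadd_exp_def)
  qed (use q in \<open>simp add: subadd_exp_def\<close>)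
qed

lemma lp_le_infinity: "lp_le top I x t \<longleftrightarrow> (\<forall>i\<in>I. x i \<le> t)"
  by (simp add: lp_le_def)

lemma lp_le_finite_exponent:
  "p \<noteq> \<infinity> \<Longrightarrow> lp_le p I x t \<longleftrightarrow> (\<forall>F. finite F \<longrightarrow> F \<subseteq> I \<longrightarrow>
     (\<Sum>i\<in>F. x i powr enn2real p) \<le> t powr (enn2real p / subadd_exp p))"
  by (simp add: lp_le_def)

lemma lp_leD:
  "lp_le p I x t \<Longrightarrow> p \<noteq> \<infinity> \<Longrightarrow> finite F \<Longrightarrow> F \<subseteq> I \<Longrightarrow>
     (\<Sum>i\<in>F. x i powr enn2real p) \<le> t powr (enn2real p / subadd_exp p)"
  by (simp add: lp_le_def)

lemma lp_exponent_cases [consumes 1, case_names infinity le_1 ge_1]: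
  assumes "0 < (p :: ennreal)"
  obtains "p = \<infinity>" "subadd_exp p = 1"
    | "p \<noteq> \<infinity>" "0 < enn2real p" "enn2real p \<le> 1" "subadd_exp p = enn2real p"
    | "p \<noteq> \<infinity>" "1 \<le> enn2real p" "subadd_exp p = 1"
proof -
  consider "p = \<infinity>" | "p \<noteq> \<infinity>" "enn2real p \<le> 1" | "p \<noteq> \<infinity>" "1 \<le> enn2real p"
    by linarith
  then show ?thesis
  proof cases
    case 1 then show ?thesis using that(1) by (simp add: subadd_exp_def)
  next
    case 2 then show ?thesis using that(2) assms
      by (auto simp: subadd_exp_def enn2real_positive_iff less_top)
  next
    case 3 then show ?thesis using that(3) by (simp add: subadd_exp_def)
  qed
qed

lemma lp_le_mono:
  assumes p: "0 < p" and le: "lp_le p I x s" "J \<subseteq> I" "s \<le> t" "0 \<le> s"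
    and y: "\<And>i. i \<in> J \<Longrightarrow> 0 \<le> y i" "\<And>i. i \<in> J \<Longrightarrow> y i \<le> x i"
  shows "lp_le p J y t"
proof (cases "p = \<infinity>")
  case True
  with le y show ?thesis by (force simp: lp_le_infinity)
next
  case False
  show ?thesis unfolding lp_le_finite_exponent[OF False]
  proof (intro allI impI)
    fix F assume F: "finite F" "F \<subseteq> J"
    have "(\<Sum>i\<in>F. y i powr enn2real p) \<le> (\<Sum>i\<in>F. x i powr enn2real p)"
      using F y by (intro sum_mono powr_mono2) auto
    also have "\<dots> \<le> s powr (enn2real p / subadd_exp p)"
      using le F by (auto simp: lp_le_finite_exponent[OF False])
    also have "\<dots> \<le> t powr (enn2real p / subadd_exp p)"
      using le subadd_exp_pos[OF p] by (intro powr_mono2) auto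
    finally show "(\<Sum>i\<in>F. y i powr enn2real p) \<le> t powr (enn2real p / subadd_exp p)" .
  qed
qed

lemma lp_le_entry:
  assumes p: "0 < p" and le: "lp_le p I x t" and t: "0 \<le> t" and i: "i \<in> I" "0 \<le> x i"
  shows "x i powr subadd_exp p \<le> t"
  using p
proof (cases rule: lp_exponent_cases)
  case infinity
  with le i show ?thesis by (simp add: lp_le_infinity)
next
  case le_1
  then have "(\<Sum>j\<in>{i}. x j powr enn2real p) \<le> t powr (enn2real p / subadd_exp p)"
    using le i by (intro lp_leD) auto
  then show ?thesis using le_1 t by simp
next
  case ge_1
  then have "(\<Sum>j\<in>{i}. x j powr enn2real p) \<le> t powr (enn2real p / subadd_exp p)"
    using le i by (intro lp_leD) auto
  then have "x i powr enn2real p \<le> t powr enn2real p" using ge_1 by simp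
  then have "x i \<le> t"
    using ge_1 t i by (meson linorder_not_le powr_less_mono2 order.strict_trans2 zero_less_one)
  then show ?thesis using ge_1 i by simp
qed

text \<open>
  The constant \<open>2\<close> is not optimal. It avoids Minkowski's inequality and is harmless where
  the lemma is used, because the kernel of the localized estimate can be made as small as desired.
\<close>

lemma lp_le_add:
  assumes p: "0 < p" and x: "lp_le p I x s" "0 \<le> s" "\<And>i. i \<in> I \<Longrightarrow> 0 \<le> x i"
    and y: "lp_le p I y t" "0 \<le> t" "\<And>i. i \<in> I \<Longrightarrow> 0 \<le> y i"
  shows "lp_le p I (\<lambda>i. x i + y i) (2 * (s + t))"
  using p
proof (cases rule: lp_exponent_cases)
  case infinity
  with x y show ?thesis by (fastforce simp: lp_le_infinity)
next
  case le_1
  show ?thesis unfolding lp_le_finite_exponent[OF le_1(1)]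
  proof (intro allI impI)
    fix F assume F: "finite F" "F \<subseteq> I"
    have "(x i + y i) powr enn2real p \<le> x i powr enn2real p + y i powr enn2real p" if "i \<in> F" for i
      using powr_sum_le_sum_powr[of "UNIV :: bool set" "\<lambda>b. if b then x i else y i" "enn2real p"]
        le_1 x y F that by (auto simp: UNIV_bool add.commute split: if_splits)
    then have "(\<Sum>i\<in>F. (x i + y i) powr enn2real p)
        \<le> (\<Sum>i\<in>F. x i powr enn2real p) + (\<Sum>i\<in>F. y i powr enn2real p)"
      unfolding sum.distrib[symmetric] by (intro sum_mono)
    also have "\<dots> \<le> s powr (enn2real p / subadd_exp p) + t powr (enn2real p / subadd_exp p)"
      using x y F by (intro add_mono) (auto simp: lp_le_finite_exponent[OF le_1(1)])
    also have "\<dots> \<le> (2 * (s + t)) powr (enn2real p / subadd_exp p)"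
      using x y le_1 by simp
    finally show "(\<Sum>i\<in>F. (x i + y i) powr enn2real p) \<le> (2 * (s + t)) powr (enn2real p / subadd_exp p)" .
  qed
next
  case ge_1
  show ?thesis unfolding lp_le_finite_exponent[OF ge_1(1)]
  proof (intro allI impI)
    fix F assume F: "finite F" "F \<subseteq> I"
    let ?p = "enn2real p"
    have "(x i + y i) powr ?p \<le> 2 powr ?p * (x i powr ?p + y i powr ?p)" if "i \<in> F" for i
    proof -
      have xy: "0 \<le> x i" "0 \<le> y i" using x y F that by auto
      have "(x i + y i) powr ?p \<le> (2 * max (x i) (y i)) powr ?p"
        using xy ge_1 by (intro powr_mono2) auto
      also have "\<dots> = 2 powr ?p * max (x i) (y i) powr ?p"
        using xy by (simp add: powr_mult)
      also have "max (x i) (y i) powr ?p \<le> x i powr ?p + y i powr ?p"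
        by (auto simp: max_def)
      finally show ?thesis by simp
    qed
    then have "(\<Sum>i\<in>F. (x i + y i) powr ?p)
        \<le> 2 powr ?p * ((\<Sum>i\<in>F. x i powr ?p) + (\<Sum>i\<in>F. y i powr ?p))"
      unfolding sum.distrib[symmetric] sum_distrib_left by (intro sum_mono)
    also have "\<dots> \<le> 2 powr ?p * (s powr ?p + t powr ?p)"
      using x y F ge_1 by (intro mult_left_mono add_mono) (auto simp: lp_le_finite_exponent[OF ge_1(1)])
    also have "s powr ?p + t powr ?p \<le> (s + t) powr ?p"
      using sum_powr_le_powr_sum[of "UNIV :: bool set" "\<lambda>b. if b then s else t" ?p]
        ge_1 x y by (auto simp: UNIV_bool add.commute split: if_splits)
    finally show "(\<Sum>i\<in>F. (x i + y i) powr ?p) \<le> (2 * (s + t)) powr (?p / subadd_exp p)"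
      unfolding powr_mult using ge_1 by simp
  qed
qed

lemma lp_le_limit:
  assumes p: "0 < p" and lim: "\<And>i. i \<in> I \<Longrightarrow> ((\<lambda>a. y a i) \<longlongrightarrow> z i) \<F>" and "\<F> \<noteq> bot"
    and nonneg: "eventually (\<lambda>a. \<forall>i\<in>I. 0 \<le> y a i) \<F>"
    and le: "eventually (\<lambda>a. lp_le p I (y a) t) \<F>"
  shows "lp_le p I z t"
proof (cases "p = \<infinity>")
  case True
  show ?thesis unfolding True infinity_ennreal_def lp_le_infinity
  proof
    fix i assume "i \<in> I"
    then show "z i \<le> t"
      using tendsto_upperbound[OF lim[OF \<open>i \<in> I\<close>] _ \<open>\<F> \<noteq> bot\<close>] eventually_mono[OF le]
      by (simp add: True lp_le_infinity)
  qed
next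
  case False
  then have p': "0 < enn2real p" using p by (simp add: enn2real_positive_iff less_top)
  show ?thesis unfolding lp_le_finite_exponent[OF False]
  proof (intro allI impI)
    fix F assume F: "finite F" "F \<subseteq> I"
    have "((\<lambda>a. y a i powr enn2real p) \<longlongrightarrow> z i powr enn2real p) \<F>" if "i \<in> F" for i
      using lim[of i] p' that F
      by (intro tendsto_powr' tendsto_const) (auto intro!: disjI2 eventually_mono[OF nonneg])
    then have *: "((\<lambda>a. \<Sum>i\<in>F. y a i powr enn2real p) \<longlongrightarrow> (\<Sum>i\<in>F. z i powr enn2real p)) \<F>"
      by (intro tendsto_sum)
    show "(\<Sum>i\<in>F. z i powr enn2real p) \<le> t powr (enn2real p / subadd_exp p)"
      using tendsto_upperbound[OF * _ \<open>\<F> \<noteq> bot\<close>] eventually_mono[OF le] F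
      by (simp add: lp_le_finite_exponent[OF False])
  qed
qed

lemma summable_onI_nonneg:
  fixes f :: "'i \<Rightarrow> real"
  assumes "\<And>i. i \<in> I \<Longrightarrow> 0 \<le> f i" and "\<And>F. finite F \<Longrightarrow> F \<subseteq> I \<Longrightarrow> sum f F \<le> C"
  shows "f summable_on I"
  using assms by (intro nonneg_bdd_above_summable_on) (auto intro!: bdd_aboveI2)

text \<open>
  This equivalence and the estimates of \<^const>\<open>lp_norm\<close> below translate between the sequence spaces
  with their quasi-norms and the finite bounds \<^const>\<open>lp_le\<close>.
\<close>

lemma lp_space_eq_lp_le:
  assumes p: "0 < p"
  shows "u \<in> lp_space p I \<longleftrightarrow>
    (\<forall>i. i \<notin> I \<longrightarrow> u i = 0) \<and> (\<exists>t\<ge>0. lp_le p UNIV (\<lambda>i. norm (u i)) t)"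
proof (cases "p = \<infinity>")
  case True
  have "bounded (range u) \<longleftrightarrow> (\<exists>t\<ge>0. \<forall>i. norm (u i) \<le> t)"
    unfolding bounded_iff
    by (auto, metis abs_ge_self abs_ge_zero order_trans)
  then show ?thesis by (simp add: True lp_space_def lp_le_infinity)
next
  case False
  let ?q = "enn2real p / subadd_exp p"
  have q: "0 < enn2real p" "0 < subadd_exp p"
    using p False subadd_exp_pos[OF p] by (simp_all add: enn2real_positive_iff less_top)
  have "(\<lambda>i. norm (u i) powr enn2real p) summable_on UNIV \<longleftrightarrow>
      (\<exists>t\<ge>0. \<forall>F. finite F \<longrightarrow> (\<Sum>i\<in>F. norm (u i) powr enn2real p) \<le> t powr ?q)"
    (is "?l \<longleftrightarrow> ?r")
  proof
    assume ?l
    show ?r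
    proof (intro exI conjI allI impI)
      fix F :: "'a set" assume "finite F"
      have "(\<Sum>i\<in>F. norm (u i) powr enn2real p) \<le> (\<Sum>\<^sub>\<infinity>i. norm (u i) powr enn2real p)"
        using \<open>?l\<close> \<open>finite F\<close> by (intro finite_sum_le_infsum) auto
      also have "\<dots> = ((\<Sum>\<^sub>\<infinity>i. norm (u i) powr enn2real p) powr (1 / ?q)) powr ?q"
        unfolding powr_powr using q by (simp add: infsum_nonneg)
      finally show "(\<Sum>i\<in>F. norm (u i) powr enn2real p)
        \<le> ((\<Sum>\<^sub>\<infinity>i. norm (u i) powr enn2real p) powr (1 / ?q)) powr ?q" .
    qed auto
  next
    assume ?r
    then show ?l by (auto intro!: summable_onI_nonneg)
  qed
  with False show ?thesis by (simp add: lp_space_def lp_le_finite_exponent)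
qed

lemma lp_le_UNIV:
  assumes p: "0 < p" and t: "0 \<le> t" and u: "\<And>i. i \<notin> I \<Longrightarrow> u i = 0" and le: "lp_le p I (\<lambda>i. norm (u i)) t"
  shows "lp_le p UNIV (\<lambda>i. norm (u i)) t"
proof (cases "p = \<infinity>")
  case True
  have "norm (u i) \<le> t" for i
    using assms True by (cases "i \<in> I") (auto simp: lp_le_infinity)
  then show ?thesis using True by (simp add: lp_le_infinity)
next
  case False
  show ?thesis unfolding lp_le_finite_exponent[OF False]
  proof (intro allI impI)
    fix F :: "'a set" assume F: "finite F"
    have "(\<Sum>i\<in>F. norm (u i) powr enn2real p) = (\<Sum>i\<in>F \<inter> I. norm (u i) powr enn2real p)"
      using F u by (intro sum.mono_neutral_right) auto
    also have "\<dots> \<le> t powr (enn2real p / subadd_exp p)"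
      using F by (intro lp_leD[OF le False]) auto
    finally show "(\<Sum>i\<in>F. norm (u i) powr enn2real p) \<le> t powr (enn2real p / subadd_exp p)" .
  qed
qed

lemma lp_space_I:
  assumes p: "0 < p" and "0 \<le> t" and "\<And>i. i \<notin> I \<Longrightarrow> u i = 0" and "lp_le p I (\<lambda>i. norm (u i)) t"
  shows "u \<in> lp_space p I"
  using assms lp_le_UNIV[OF assms] by (auto simp: lp_space_eq_lp_le[OF p])

lemma lp_norm_nonneg: "u \<in> lp_space p I \<Longrightarrow> 0 \<le> lp_norm p u"
proof (cases "p = \<infinity>")
  case True
  assume "u \<in> lp_space p I"
  then have "bdd_above (range (\<lambda>i. norm (u i)))"
    using True by (auto simp: lp_space_def bounded_iff bdd_above_def)
  then have "norm (u undefined) \<le> (SUP i. norm (u i))" by (intro cSUP_upper) auto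
  then have "0 \<le> (SUP i. norm (u i))" by (rule order_trans[OF norm_ge_zero])
  then show ?thesis using True by (simp add: lp_norm_def)
qed (simp add: lp_norm_def)

lemma lp_norm_le:
  assumes p: "0 < p" and u: "u \<in> lp_space p I" and t: "0 \<le> t"
    and le: "lp_le p UNIV (\<lambda>i. norm (u i)) t"
  shows "lp_norm p u powr subadd_exp p \<le> t"
proof (cases "p = \<infinity>")
  case True
  have "(SUP i. norm (u i)) \<le> t"
    using le True by (intro cSUP_least) (auto simp: lp_le_infinity)
  then show ?thesis using lp_norm_nonneg[OF u] True
    by (simp add: lp_norm_def subadd_exp_def)
next
  case False
  let ?q = "enn2real p / subadd_exp p"
  have q: "0 < ?q" "0 < subadd_exp p" "0 < enn2real p"
    using p False subadd_exp_pos[OF p] by (simp_all add: enn2real_positive_iff less_top)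
  have "(\<Sum>\<^sub>\<infinity>i. norm (u i) powr enn2real p) \<le> t powr ?q"
    using u False lp_leD[OF le False] by (intro infsum_le_finite_sums) (auto simp: lp_space_def)
  then have "(\<Sum>\<^sub>\<infinity>i. norm (u i) powr enn2real p) powr (1 / ?q) \<le> (t powr ?q) powr (1 / ?q)"
    using q by (intro powr_mono2 infsum_nonneg) auto
  also have "(t powr ?q) powr (1 / ?q) = t" unfolding powr_powr using q t by simp
  finally show ?thesis using False q by (simp add: lp_norm_def powr_powr)
qed

lemma lp_le_lp_norm:
  assumes p: "0 < p" and u: "u \<in> lp_space p I"
  shows "lp_le p J (\<lambda>i. norm (u i)) (lp_norm p u powr subadd_exp p)"
proof (cases "p = \<infinity>")
  case True
  have "bdd_above (range (\<lambda>i. norm (u i)))"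
    using True u by (auto simp: lp_space_def bounded_iff bdd_above_def)
  then have "norm (u i) \<le> (SUP i. norm (u i))" for i by (intro cSUP_upper) auto
  then show ?thesis using lp_norm_nonneg[OF u] True
    by (simp add: lp_norm_def subadd_exp_def lp_le_infinity)
next
  case False
  have q: "0 < subadd_exp p" "0 < enn2real p"
    using p False subadd_exp_pos[OF p] by (simp_all add: enn2real_positive_iff less_top)
  have s: "(\<lambda>i. norm (u i) powr enn2real p) summable_on UNIV"
    using u False by (simp add: lp_space_def)
  show ?thesis unfolding lp_le_finite_exponent[OF False]
  proof (intro allI impI)
    fix F assume F: "finite F" "F \<subseteq> J"
    have "(\<Sum>i\<in>F. norm (u i) powr enn2real p) \<le> (\<Sum>\<^sub>\<infinity>i. norm (u i) powr enn2real p)"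
      using F by (intro finite_sum_le_infsum s) auto
    also have "\<dots> = (lp_norm p u powr subadd_exp p) powr (enn2real p / subadd_exp p)"
      using q False by (simp add: lp_norm_def powr_powr infsum_nonneg)
    finally show "(\<Sum>i\<in>F. norm (u i) powr enn2real p)
      \<le> (lp_norm p u powr subadd_exp p) powr (enn2real p / subadd_exp p)" .
  qed
qed

lemma lp_space_add:
  assumes p: "0 < p" and c: "c \<in> lp_space p I" and d: "d \<in> lp_space p I"
  shows "(\<lambda>i. c i + d i) \<in> lp_space p I"
proof -
  let ?s = "lp_norm p c powr subadd_exp p" and ?t = "lp_norm p d powr subadd_exp p"
  have "lp_le p UNIV (\<lambda>i. norm (c i) + norm (d i)) (2 * (?s + ?t))"
    using c d by (intro lp_le_add[OF p] lp_le_lp_norm[OF p]) auto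
  then have "lp_le p UNIV (\<lambda>i. norm (c i + d i)) (2 * (?s + ?t))"
    by (rule lp_le_mono[OF p]) (auto simp: norm_triangle_ineq)
  then show ?thesis using c d
    by (auto simp: lp_space_eq_lp_le[OF p] intro!: exI[of _ "2 * (?s + ?t)"])
qed

lemma lp_space_scale: "c \<in> lp_space p I \<Longrightarrow> (\<lambda>i. z * c i) \<in> lp_space p I"
  by (auto simp: lp_space_def norm_mult powr_mult bounded_iff intro!: summable_on_cmult_right
      split: if_splits)
    (metis mult_left_mono norm_ge_zero)

definition unit_seq :: "'i \<Rightarrow> 'i \<Rightarrow> complex" where
  "unit_seq l = (\<lambda>i. if i = l then 1 else 0)"

lemma unit_seq_lp_le: "0 < p \<Longrightarrow> 0 \<le> t \<Longrightarrow> norm z powr subadd_exp p \<le> t \<Longrightarrow>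
    lp_le p I (\<lambda>i. norm (z * unit_seq l i)) t"
proof -
  assume p: "0 < p" and t: "0 \<le> t" and z: "norm z powr subadd_exp p \<le> t"
  show "lp_le p I (\<lambda>i. norm (z * unit_seq l i)) t"
  proof (cases "p = \<infinity>")
    case True
    then show ?thesis using z t by (auto simp: lp_le_infinity unit_seq_def subadd_exp_def)
  next
    case False
    show ?thesis unfolding lp_le_finite_exponent[OF False]
    proof (intro allI impI)
      fix F assume F: "finite F" "F \<subseteq> I"
      have "(\<Sum>i\<in>F. norm (z * unit_seq l i) powr enn2real p) = (\<Sum>i\<in>F. if i = l then norm z powr enn2real p else 0)"
        by (intro sum.cong) (auto simp: unit_seq_def)
      also have "\<dots> \<le> norm z powr enn2real p" using F by simp
      also have "\<dots> = (norm z powr subadd_exp p) powr (enn2real p / subadd_exp p)"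
        using subadd_exp_pos[OF p] by (simp add: powr_powr)
      also have "\<dots> \<le> t powr (enn2real p / subadd_exp p)"
        using z subadd_exp_pos[OF p] by (intro powr_mono2) auto
      finally show "(\<Sum>i\<in>F. norm (z * unit_seq l i) powr enn2real p) \<le> t powr (enn2real p / subadd_exp p)" .
    qed
  qed
qed

lemma unit_seq_lp_space: "0 < p \<Longrightarrow> l \<in> I \<Longrightarrow> unit_seq l \<in> lp_space p I"
  using unit_seq_lp_le[of p 1 1 I l] by (intro lp_space_I[where t = 1]) (auto simp: unit_seq_def)

section \<open>A block form of Schur's test\<close>

lemma sum_le_sum_over_blocks:
  fixes f :: "'i \<Rightarrow> real"
  assumes "finite G" and "\<And>j. j \<in> b ` G \<Longrightarrow> (\<Sum>i\<in>{i\<in>G. b i = j}. f i) \<le> h j"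
  shows "(\<Sum>i\<in>G. f i) \<le> (\<Sum>j\<in>b ` G. h j)"
proof -
  have "(\<Sum>i\<in>G. f i) = (\<Sum>j\<in>b ` G. \<Sum>i\<in>{i\<in>G. b i = j}. f i)"
    using assms(1) by (intro sum.group[symmetric]) auto
  then show ?thesis using assms(2) by (auto intro: sum_mono)
qed

lemma block_schur_le_1:
  fixes m :: "'i \<Rightarrow> 'j \<Rightarrow> real"
  assumes fin: "finite F" "finite G" and p: "0 < p" "p \<le> 1"
    and m: "\<And>i j. i \<in> F \<Longrightarrow> j \<in> G \<Longrightarrow> 0 \<le> m i j" and x: "\<And>j. j \<in> G \<Longrightarrow> 0 \<le> x j"
    and cols: "\<And>j. j \<in> G \<Longrightarrow> (\<Sum>i\<in>F. m i j powr p) \<le> V (b j)"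
    and V: "\<And>k. 0 \<le> V k"
    and blocks: "\<And>k. (\<Sum>j\<in>{j\<in>G. b j = k}. x j powr p) \<le> N k"
  shows "(\<Sum>i\<in>F. (\<Sum>j\<in>G. m i j * x j) powr p) \<le> (\<Sum>k\<in>b ` G. V k * N k)"
proof -
  have "(\<Sum>i\<in>F. (\<Sum>j\<in>G. m i j * x j) powr p) \<le> (\<Sum>i\<in>F. \<Sum>j\<in>G. (m i j * x j) powr p)"
    using fin p m x by (intro sum_mono powr_sum_le_sum_powr) auto
  also have "\<dots> = (\<Sum>i\<in>F. \<Sum>j\<in>G. m i j powr p * x j powr p)"
    by (simp add: powr_mult)
  also have "\<dots> = (\<Sum>j\<in>G. (\<Sum>i\<in>F. m i j powr p) * x j powr p)"
    by (subst sum.swap) (simp add: sum_distrib_right)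
  also have "\<dots> \<le> (\<Sum>j\<in>G. V (b j) * x j powr p)"
    using cols by (intro sum_mono mult_right_mono) auto
  also have "\<dots> \<le> (\<Sum>k\<in>b ` G. V k * N k)"
    using V blocks
    by (intro sum_le_sum_over_blocks fin) (auto simp: sum_distrib_left[symmetric] intro!: mult_left_mono)
  finally show ?thesis .
qed

text \<open>
  Jensen's inequality is applied to \<open>m i j * x j = (m i j * N (b j)) * (x j / N (b j))\<close> with the first
  factor as weight. This choice of weights performs Schur's test in each block and
  Minkowski's inequality over the blocks at once: the weights sum to at most
  \<open>T = (\<Sum>k. V k * N k)\<close>, and the values are normalized in each block.
\<close>

lemma block_schur_ge_1:
  fixes m :: "'i \<Rightarrow> 'j \<Rightarrow> real"
  assumes fin: "finite F" "finite G" and p: "1 \<le> p"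
    and m: "\<And>i j. i \<in> F \<Longrightarrow> j \<in> G \<Longrightarrow> 0 \<le> m i j" and x: "\<And>j. j \<in> G \<Longrightarrow> 0 \<le> x j"
    and rows: "\<And>i k. i \<in> F \<Longrightarrow> (\<Sum>j\<in>{j\<in>G. b j = k}. m i j) \<le> V k"
    and cols: "\<And>j. j \<in> G \<Longrightarrow> (\<Sum>i\<in>F. m i j) \<le> V (b j)"
    and V: "\<And>k. 0 \<le> V k" and N: "\<And>k. 0 \<le> N k"
    and blocks: "\<And>k. (\<Sum>j\<in>{j\<in>G. b j = k}. x j powr p) \<le> N k powr p"
  shows "(\<Sum>i\<in>F. (\<Sum>j\<in>G. m i j * x j) powr p) \<le> (\<Sum>k\<in>b ` G. V k * N k) powr p"
proof -
  define T where "T = (\<Sum>k\<in>b ` G. V k * N k)"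
  have T: "0 \<le> T" unfolding T_def using V N by (intro sum_nonneg) auto
  \<comment> \<open>For \<open>N (b j) = 0\<close> this is \<open>0\<close>, in accordance with \<open>x j = 0\<close>.\<close>
  define y where "y j = x j / N (b j)" for j
  have y: "0 \<le> y j" if "j \<in> G" for j using x N that by (simp add: y_def)
  have x_le: "x j powr p \<le> N (b j) powr p" if "j \<in> G" for j
  proof -
    have "x j powr p \<le> (\<Sum>j'\<in>{j'\<in>G. b j' = b j}. x j' powr p)"
      using fin that by (intro member_le_sum) auto
    then show ?thesis using blocks[of "b j"] by simp
  qed
  have x_eq: "x j = N (b j) * y j" if "j \<in> G" for j
    using x_le[OF that] by (auto simp: y_def)
  have y_blocks: "(\<Sum>j\<in>{j\<in>G. b j = k}. y j powr p) \<le> 1" for k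
  proof (cases "N k = 0")
    case True
    then show ?thesis by (simp add: y_def)
  next
    case False
    have "(\<Sum>j\<in>{j\<in>G. b j = k}. y j powr p) = (\<Sum>j\<in>{j\<in>G. b j = k}. x j powr p) / N k powr p"
      unfolding sum_divide_distrib using x N by (intro sum.cong) (auto simp: y_def powr_divide)
    also have "\<dots> \<le> 1" using blocks[of k] False N[of k] by (simp add: divide_le_eq)
    finally show ?thesis .
  qed
  have row: "(\<Sum>j\<in>G. m i j * x j) powr p \<le> T powr (p - 1) * (\<Sum>j\<in>G. (m i j * N (b j)) * y j powr p)"
    if i: "i \<in> F" for i
  proof -
    have "(\<Sum>j\<in>G. m i j * x j) = (\<Sum>j\<in>G. (m i j * N (b j)) * y j)"
      using x_eq by (intro sum.cong) auto
    then have "(\<Sum>j\<in>G. m i j * x j) powr p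
        \<le> (\<Sum>j\<in>G. m i j * N (b j)) powr (p - 1) * (\<Sum>j\<in>G. (m i j * N (b j)) * y j powr p)"
      using fin p m N i y by (auto intro!: weighted_power_mean)
    also have "\<dots> \<le> T powr (p - 1) * (\<Sum>j\<in>G. (m i j * N (b j)) * y j powr p)"
    proof (intro mult_right_mono powr_mono2)
      show "(\<Sum>j\<in>G. m i j * N (b j)) \<le> T" unfolding T_def
        using rows[OF i] N
        by (intro sum_le_sum_over_blocks fin) (auto simp: sum_distrib_right[symmetric] intro!: mult_right_mono)
    qed (use p m N i in \<open>auto intro!: sum_nonneg\<close>)
    finally show ?thesis .
  qed
  have "(\<Sum>i\<in>F. \<Sum>j\<in>G. (m i j * N (b j)) * y j powr p)
      = (\<Sum>j\<in>G. (\<Sum>i\<in>F. m i j) * (N (b j) * y j powr p))"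
    by (subst sum.swap) (simp add: sum_distrib_right sum_distrib_left mult_ac)
  also have "\<dots> \<le> (\<Sum>j\<in>G. V (b j) * (N (b j) * y j powr p))"
    using cols N by (intro sum_mono mult_right_mono) auto
  also have "\<dots> \<le> T" unfolding T_def
  proof (intro sum_le_sum_over_blocks fin)
    fix k assume "k \<in> b ` G"
    have "(\<Sum>j\<in>{j\<in>G. b j = k}. V (b j) * (N (b j) * y j powr p))
        = V k * N k * (\<Sum>j\<in>{j\<in>G. b j = k}. y j powr p)"
      by (simp add: sum_distrib_left mult_ac)
    also have "\<dots> \<le> V k * N k * 1"
      using y_blocks V N by (intro mult_left_mono) auto
    finally show "(\<Sum>j\<in>{j\<in>G. b j = k}. V (b j) * (N (b j) * y j powr p)) \<le> V k * N k" by simp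
  qed
  finally have total: "(\<Sum>i\<in>F. \<Sum>j\<in>G. (m i j * N (b j)) * y j powr p) \<le> T" .
  have "(\<Sum>i\<in>F. (\<Sum>j\<in>G. m i j * x j) powr p)
      \<le> (\<Sum>i\<in>F. T powr (p - 1) * (\<Sum>j\<in>G. (m i j * N (b j)) * y j powr p))"
    using row by (intro sum_mono)
  also have "\<dots> = T powr (p - 1) * (\<Sum>i\<in>F. \<Sum>j\<in>G. (m i j * N (b j)) * y j powr p)"
    by (rule sum_distrib_left[symmetric])
  also have "\<dots> \<le> T powr (p - 1) * T" using total by (intro mult_left_mono) auto
  also have "\<dots> = T powr p"
    using powr_mult_base[OF T, of "p - 1"] by (simp add: mult.commute)
  finally show ?thesis by (simp add: T_def)
qed

lemma block_schur_finite:
  fixes m :: "'i \<Rightarrow> 'j \<Rightarrow> real" and p :: ennreal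
  defines "r \<equiv> subadd_exp p"
  assumes p: "0 < p" and G: "finite G" "G \<subseteq> J"
    and m: "\<And>i j. i \<in> I \<Longrightarrow> j \<in> J \<Longrightarrow> 0 \<le> m i j" and x: "\<And>j. j \<in> J \<Longrightarrow> 0 \<le> x j"
    and rows: "\<And>i k G. i \<in> I \<Longrightarrow> finite G \<Longrightarrow> G \<subseteq> {j\<in>J. b j = k} \<Longrightarrow> (\<Sum>j\<in>G. m i j powr r) \<le> V k"
    and cols: "\<And>j F. j \<in> J \<Longrightarrow> finite F \<Longrightarrow> F \<subseteq> I \<Longrightarrow> (\<Sum>i\<in>F. m i j powr r) \<le> V (b j)"
    and V: "\<And>k. 0 \<le> V k" and N: "\<And>k. 0 \<le> N k"
    and blocks: "\<And>k. lp_le p {j\<in>J. b j = k} x (N k)"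
  shows "lp_le p I (\<lambda>i. \<Sum>j\<in>G. m i j * x j) (\<Sum>k\<in>b ` G. V k * N k)"
  using p
proof (cases rule: lp_exponent_cases)
  case infinity
  have *: "(\<Sum>j\<in>G. m i j * x j) \<le> (\<Sum>k\<in>b ` G. V k * N k)" if i: "i \<in> I" for i
  proof (intro sum_le_sum_over_blocks G)
    fix k
    have Gk: "finite {j\<in>G. b j = k}" "{j\<in>G. b j = k} \<subseteq> {j\<in>J. b j = k}" using G by auto
    have "(\<Sum>j\<in>{j\<in>G. b j = k}. m i j * x j) \<le> (\<Sum>j\<in>{j\<in>G. b j = k}. m i j powr r * N k)"
      using blocks[of k] m[OF i] x N G infinity
      by (intro sum_mono mult_mono) (auto simp: lp_le_infinity r_def)
    also have "\<dots> \<le> V k * N k"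
      unfolding sum_distrib_right[symmetric] using rows[OF i Gk] N by (intro mult_right_mono)
    finally show "(\<Sum>j\<in>{j\<in>G. b j = k}. m i j * x j) \<le> V k * N k" .
  qed
  then show ?thesis using infinity by (simp add: lp_le_infinity)
next
  case le_1
  show ?thesis unfolding lp_le_finite_exponent[OF le_1(1)]
  proof (intro allI impI)
    fix F assume F: "finite F" "F \<subseteq> I"
    have "(\<Sum>i\<in>F. (\<Sum>j\<in>G. m i j * x j) powr enn2real p) \<le> (\<Sum>k\<in>b ` G. V k * N k)"
    proof (rule block_schur_le_1)
      show "(\<Sum>j\<in>{j\<in>G. b j = k}. x j powr enn2real p) \<le> N k" for k
      proof -
        have "finite {j\<in>G. b j = k}" "{j\<in>G. b j = k} \<subseteq> {j\<in>J. b j = k}" using G by auto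
        with blocks[of k] N[of k] le_1 show ?thesis
          by (simp add: lp_le_finite_exponent)
      qed
    qed (use F G le_1 m x cols V in \<open>auto simp: r_def\<close>)
    then show "(\<Sum>i\<in>F. (\<Sum>j\<in>G. m i j * x j) powr enn2real p)
        \<le> (\<Sum>k\<in>b ` G. V k * N k) powr (enn2real p / subadd_exp p)"
      using le_1 V N by (simp add: sum_nonneg)
  qed
next
  case ge_1
  show ?thesis unfolding lp_le_finite_exponent[OF ge_1(1)]
  proof (intro allI impI)
    fix F assume F: "finite F" "F \<subseteq> I"
    have r1: "(\<Sum>j\<in>A. m i j powr r) = (\<Sum>j\<in>A. m i j)" if "i \<in> I" "A \<subseteq> J" for A i
      using that m ge_1 by (intro sum.cong) (auto simp: r_def)
    have r2: "(\<Sum>i\<in>F. m i j powr r) = (\<Sum>i\<in>F. m i j)" if "j \<in> J" for j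
      using that m ge_1 F by (intro sum.cong) (auto simp: r_def)
    have "(\<Sum>i\<in>F. (\<Sum>j\<in>G. m i j * x j) powr enn2real p) \<le> (\<Sum>k\<in>b ` G. V k * N k) powr enn2real p"
    proof (rule block_schur_ge_1)
      fix k
      have Gk: "finite {j\<in>G. b j = k}" "{j\<in>G. b j = k} \<subseteq> {j\<in>J. b j = k}" using G by auto
      with blocks[of k] N[of k] ge_1
      show "(\<Sum>j\<in>{j\<in>G. b j = k}. x j powr enn2real p) \<le> N k powr enn2real p"
        by (simp add: lp_le_finite_exponent)
      show "(\<Sum>j\<in>{j\<in>G. b j = k}. m i j) \<le> V k" if "i \<in> F" for i
        proof -
        have "i \<in> I" "{j\<in>G. b j = k} \<subseteq> J" using that F G by auto
        then show ?thesis using rows[OF \<open>i \<in> I\<close> Gk] r1 by simp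
      qed
      show "(\<Sum>i\<in>F. m i j) \<le> V (b j)" if "j \<in> G" for j
        using cols[of j F] r2[of j] that F G by auto
    qed (use F G ge_1 m x V N in auto)
    then show "(\<Sum>i\<in>F. (\<Sum>j\<in>G. m i j * x j) powr enn2real p)
        \<le> (\<Sum>k\<in>b ` G. V k * N k) powr (enn2real p / subadd_exp p)"
      using ge_1 by simp
  qed
qed

text \<open>
  The columns of \<open>m\<close> are grouped into the fibres of \<open>b\<close>, and \<open>V k\<close> dominates the \<open>r\<close>-th power of
  the norm of \<open>m\<close> on the \<open>k\<close>-th block as an operator on \<open>\<ell>\<^sup>p\<close>, by Schur's test. The conclusion is the triangle inequality
  \<open>\<parallel>m x\<parallel>\<^sub>p\<^sup>r \<le> (\<Sum>k. \<parallel>m (1\<^sub>k x)\<parallel>\<^sub>p\<^sup>r)\<close> combined with these block bounds. A single block gives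
  the usual boundedness of \<open>m\<close>.
\<close>

lemma block_schur:
  fixes m :: "'i \<Rightarrow> 'j \<Rightarrow> real" and p :: ennreal
  defines "r \<equiv> subadd_exp p"
  assumes p: "0 < p"
    and m: "\<And>i j. i \<in> I \<Longrightarrow> j \<in> J \<Longrightarrow> 0 \<le> m i j" and x: "\<And>j. j \<in> J \<Longrightarrow> 0 \<le> x j"
    and rows: "\<And>i k G. i \<in> I \<Longrightarrow> finite G \<Longrightarrow> G \<subseteq> {j\<in>J. b j = k} \<Longrightarrow> (\<Sum>j\<in>G. m i j powr r) \<le> V k"
    and cols: "\<And>j F. j \<in> J \<Longrightarrow> finite F \<Longrightarrow> F \<subseteq> I \<Longrightarrow> (\<Sum>i\<in>F. m i j powr r) \<le> V (b j)"
    and V: "\<And>k. 0 \<le> V k" and N: "\<And>k. 0 \<le> N k"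
    and blocks: "\<And>k. lp_le p {j\<in>J. b j = k} x (N k)"
    and summable: "(\<lambda>k. V k * N k) summable_on UNIV"
  shows "\<And>i. i \<in> I \<Longrightarrow> (\<lambda>j. m i j * x j) summable_on J"
    and "lp_le p I (\<lambda>i. \<Sum>\<^sub>\<infinity>j\<in>J. m i j * x j) (\<Sum>\<^sub>\<infinity>k. V k * N k)"
proof -
  let ?T = "\<Sum>\<^sub>\<infinity>k. V k * N k"
  have T: "0 \<le> ?T" using V N by (intro infsum_nonneg) auto
  have fin: "lp_le p I (\<lambda>i. \<Sum>j\<in>G. m i j * x j) ?T" if G: "finite G" "G \<subseteq> J" for G
  proof (rule lp_le_mono[OF p])
    show "lp_le p I (\<lambda>i. \<Sum>j\<in>G. m i j * x j) (\<Sum>k\<in>b ` G. V k * N k)"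
      using assms G by (intro block_schur_finite[where J = J]) auto
    show "(\<Sum>k\<in>b ` G. V k * N k) \<le> ?T"
      using G V N by (intro finite_sum_le_infsum[OF summable]) auto
    show "0 \<le> (\<Sum>k\<in>b ` G. V k * N k)" using V N by (intro sum_nonneg) auto
    show "0 \<le> (\<Sum>j\<in>G. m i j * x j)" if "i \<in> I" for i
      using m x G that by (intro sum_nonneg) auto
  qed auto
  show *: "(\<lambda>j. m i j * x j) summable_on J" if i: "i \<in> I" for i
  proof (rule summable_onI_nonneg)
    show "0 \<le> m i j * x j" if "j \<in> J" for j using m x i that by auto
    fix G assume G: "finite G" "G \<subseteq> J"
    have nn: "0 \<le> (\<Sum>j\<in>G. m i j * x j)" using m x i G by (intro sum_nonneg) auto
    have "(\<Sum>j\<in>G. m i j * x j) powr r \<le> ?T"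
      using lp_le_entry[OF p fin[OF G] T i nn] by (simp add: r_def)
    then have "((\<Sum>j\<in>G. m i j * x j) powr r) powr (1 / r) \<le> ?T powr (1 / r)"
      using subadd_exp_pos[OF p] by (intro powr_mono2) (auto simp: r_def)
    then show "(\<Sum>j\<in>G. m i j * x j) \<le> ?T powr (1 / r)"
      using nn subadd_exp_pos[OF p] by (simp add: powr_powr r_def)
  qed
  show "lp_le p I (\<lambda>i. \<Sum>\<^sub>\<infinity>j\<in>J. m i j * x j) ?T"
  proof (rule lp_le_limit[OF p, where \<F> = "finite_subsets_at_top J"])
    show "((\<lambda>G. \<Sum>j\<in>G. m i j * x j) \<longlongrightarrow> (\<Sum>\<^sub>\<infinity>j\<in>J. m i j * x j)) (finite_subsets_at_top J)"
      if "i \<in> I" for i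
      using has_sum_infsum[OF *[OF that]] by (simp add: has_sum_def)
    show "\<forall>\<^sub>F G in finite_subsets_at_top J. \<forall>i\<in>I. 0 \<le> (\<Sum>j\<in>G. m i j * x j)"
      using m x by (intro eventually_finite_subsets_at_top_weakI ballI sum_nonneg) auto
    show "\<forall>\<^sub>F G in finite_subsets_at_top J. lp_le p I (\<lambda>i. \<Sum>j\<in>G. m i j * x j) ?T"
      using fin by (intro eventually_finite_subsets_at_top_weakI)
  qed auto
qed

section \<open>Neumann iteration for convolution inequalities\<close>

context
  fixes V g :: "'g::ab_group_add \<Rightarrow> real" and s G :: real
  assumes s: "0 < s" "s \<le> 1"
    and V: "\<And>n. 0 \<le> V n" "\<And>F. finite F \<Longrightarrow> (\<Sum>n\<in>F. V n powr s) \<le> 1 / 2"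
    and g: "\<And>n. 0 \<le> g n" "\<And>F. finite F \<Longrightarrow> (\<Sum>n\<in>F. g n powr s) \<le> G"
begin

text \<open>
  For \<open>s \<le> 1\<close> the convolution satisfies \<open>\<parallel>V * w\<parallel>\<^sub>s\<^sup>s \<le> \<parallel>V\<parallel>\<^sub>s\<^sup>s \<parallel>w\<parallel>\<^sub>s\<^sup>s\<close>. This is Schur's
  test on \<open>\<ell>\<^sup>s\<close> with a single block.
\<close>

lemma convolution_contracts:
  assumes w: "\<And>n. 0 \<le> w n" "\<And>F. finite F \<Longrightarrow> (\<Sum>n\<in>F. w n powr s) \<le> D"
  shows "(\<lambda>j. V (k - j) * w j) summable_on UNIV"
    and "finite F \<Longrightarrow> (\<Sum>k\<in>F. (\<Sum>\<^sub>\<infinity>j. V (k - j) * w j) powr s) \<le> D / 2"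
proof -
  let ?p = "ennreal s"
  have p: "0 < ?p" "enn2real ?p = s" "subadd_exp ?p = s" "?p \<noteq> \<infinity>"
    using s by (auto simp: subadd_exp_def ennreal_less_zero_iff)
  have D: "0 \<le> D" using w(2)[of "{}"] by simp
  have shift: "(\<Sum>j\<in>F. V (k - j) powr s) \<le> 1 / 2" "(\<Sum>j\<in>F. V (j - k) powr s) \<le> 1 / 2"
    if "finite F" for F k
  proof -
    have "(\<Sum>j\<in>F. V (k - j) powr s) = (\<Sum>n\<in>(\<lambda>j. k - j) ` F. V n powr s)"
      by (subst sum.reindex) (auto simp: inj_on_def)
    then show "(\<Sum>j\<in>F. V (k - j) powr s) \<le> 1 / 2" using V(2)[of "(\<lambda>j. k - j) ` F"] that by simp
    have "(\<Sum>j\<in>F. V (j - k) powr s) = (\<Sum>n\<in>(\<lambda>j. j - k) ` F. V n powr s)"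
      by (subst sum.reindex) (auto simp: inj_on_def)
    then show "(\<Sum>j\<in>F. V (j - k) powr s) \<le> 1 / 2" using V(2)[of "(\<lambda>j. j - k) ` F"] that by simp
  qed
  have blk: "lp_le ?p {j \<in> UNIV. () = i} w D" for i :: unit
    using D w(2) s by (simp add: lp_le_finite_exponent p)
  note bs = block_schur[where p = ?p and I = UNIV and J = UNIV and m = "\<lambda>k j. V (k - j)" and x = w
      and b = "\<lambda>_. ()" and V = "\<lambda>_. 1 / 2" and N = "\<lambda>_. D", unfolded p, OF p(1)]
  show "(\<lambda>j. V (k - j) * w j) summable_on UNIV"
    by (rule bs(1)) (use V w D blk shift in auto)
  have "lp_le ?p UNIV (\<lambda>k. \<Sum>\<^sub>\<infinity>j. V (k - j) * w j) (\<Sum>\<^sub>\<infinity>k::unit. 1 / 2 * D)"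
    by (rule bs(2)) (use V w D blk shift in auto)
  then show "finite F \<Longrightarrow> (\<Sum>k\<in>F. (\<Sum>\<^sub>\<infinity>j. V (k - j) * w j) powr s) \<le> D / 2"
    using D s by (simp add: lp_le_finite_exponent p)
qed

lemma sum_kernel_le_half: "finite F \<Longrightarrow> (\<Sum>n\<in>F. V n) \<le> 1 / 2"
proof -
  assume F: "finite F"
  have "(\<Sum>n\<in>F. V n powr 1) \<le> (1 / 2) powr (1 / s)"
    using F V s by (intro sum_powr_exponent_mono) auto
  also have "\<dots> \<le> (1 / 2) powr 1" using s by (intro powr_mono') auto
  finally show ?thesis using V by simp
qed

lemma summable_shifted_kernel: "(\<lambda>j. V (k - j)) summable_on UNIV"
  and infsum_shifted_kernel: "(\<Sum>\<^sub>\<infinity>j. V (k - j)) \<le> 1 / 2"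
proof -
  have *: "(\<Sum>j\<in>F. V (k - j)) \<le> 1 / 2" if "finite F" for F
  proof -
    have "(\<Sum>j\<in>F. V (k - j)) = (\<Sum>n\<in>(\<lambda>j. k - j) ` F. V n)"
      by (subst sum.reindex) (auto simp: inj_on_def)
    then show ?thesis using sum_kernel_le_half[of "(\<lambda>j. k - j) ` F"] that by simp
  qed
  then show "(\<lambda>j. V (k - j)) summable_on UNIV"
    using V by (intro summable_onI_nonneg[where C = "1 / 2"]) auto
  then show "(\<Sum>\<^sub>\<infinity>j. V (k - j)) \<le> 1 / 2"
    using * by (intro infsum_le_finite_sums) auto
qed

text \<open>
  The partial sums of the Neumann series \<open>g + V * g + V * V * g + \<dots>\<close>. The recursion keeps
  the sums of their \<open>s\<close>-th powers below \<open>2 G\<close>, since \<open>G + 2 G / 2 = 2 G\<close>.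
\<close>

primrec neumann :: "nat \<Rightarrow> 'g \<Rightarrow> real" where
  "neumann 0 = (\<lambda>k. 0)"
| "neumann (Suc n) = (\<lambda>k. g k + (\<Sum>\<^sub>\<infinity>j. V (k - j) * neumann n j))"

lemma neumann_bounds:
  "0 \<le> neumann n k" "finite F \<Longrightarrow> (\<Sum>k\<in>F. neumann n k powr s) \<le> 2 * G"
proof -
  have G: "0 \<le> G" using g(2)[of "{}"] by simp
  have "(\<forall>k. 0 \<le> neumann n k) \<and> (\<forall>F. finite F \<longrightarrow> (\<Sum>k\<in>F. neumann n k powr s) \<le> 2 * G)"
  proof (induction n)
    case 0
    then show ?case using G s by simp
  next
    case (Suc n)
    have nn: "0 \<le> (\<Sum>\<^sub>\<infinity>j. V (k - j) * neumann n j)" for k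
      using Suc V by (intro infsum_nonneg) auto
    have "(\<Sum>k\<in>F. neumann (Suc n) k powr s) \<le> 2 * G" if F: "finite F" for F
    proof -
      have "neumann (Suc n) k powr s \<le> g k powr s + (\<Sum>\<^sub>\<infinity>j. V (k - j) * neumann n j) powr s" for k
        using powr_sum_le_sum_powr[of "UNIV :: bool set"
            "\<lambda>b. if b then g k else (\<Sum>\<^sub>\<infinity>j. V (k - j) * neumann n j)" s] s g nn[of k]
        by (auto simp: UNIV_bool add.commute split: if_splits)
      then have "(\<Sum>k\<in>F. neumann (Suc n) k powr s)
          \<le> (\<Sum>k\<in>F. g k powr s) + (\<Sum>k\<in>F. (\<Sum>\<^sub>\<infinity>j. V (k - j) * neumann n j) powr s)"
        unfolding sum.distrib[symmetric] by (intro sum_mono)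
      also have "\<dots> \<le> G + 2 * G / 2"
        using Suc F by (intro add_mono g(2) convolution_contracts(2)) auto
      finally show ?thesis by simp
    qed
    then show ?case using nn g by simp
  qed
  then show "0 \<le> neumann n k" "finite F \<Longrightarrow> (\<Sum>k\<in>F. neumann n k powr s) \<le> 2 * G" by auto
qed

lemma neumann_Suc_mono: "neumann n k \<le> neumann (Suc n) k"
proof (induction n arbitrary: k)
  case 0
  then show ?case using neumann_bounds(1)[of "Suc 0" k] by simp
next
  case (Suc n)
  have "(\<Sum>\<^sub>\<infinity>j. V (k - j) * neumann n j) \<le> (\<Sum>\<^sub>\<infinity>j. V (k - j) * neumann (Suc n) j)"
    using convolution_contracts(1)[OF neumann_bounds, of k n]
      convolution_contracts(1)[OF neumann_bounds, of k "Suc n"] V Suc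
    by (intro infsum_mono mult_left_mono)
  then show ?case by (simp only: neumann.simps)
qed

text \<open>
  A bounded subsolution exceeds the \<open>n\<close>-th partial sum by at most \<open>M / 2 ^ n\<close>, as the kernel
  also has \<open>\<ell>\<^sup>1\<close> norm at most \<open>1 / 2\<close>. The translation by \<open>k0\<close> places the source anywhere
  without changing the partial sums, which makes the resulting majorant uniform in the position of the source.
\<close>

lemma subsolution_le_neumann:
  assumes N: "\<And>k. 0 \<le> N k" "\<And>k. N k \<le> M"
    and sub: "\<And>k. N k \<le> g (k - k0) + (\<Sum>\<^sub>\<infinity>j. V (k - j) * N j)"
  shows "N k \<le> neumann n (k - k0) + M / 2 ^ n"
proof (induction n arbitrary: k)
  case 0
  then show ?case using N by simp
next
  case (Suc n)
  have M: "0 \<le> M" using N(1)[of 0] N(2)[of 0] by simp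
  have bij: "bij_betw (\<lambda>j. j - k0) UNIV UNIV"
    by (rule bij_betwI[where g = "\<lambda>j. j + k0"]) auto
  let ?h = "\<lambda>i. V ((k - k0) - i) * neumann n i"
  have hsum: "?h summable_on UNIV"
    by (intro convolution_contracts(1)[OF neumann_bounds])
  have eq: "?h (j - k0) = V (k - j) * neumann n (j - k0)" for j by (simp add: algebra_simps)
  have sum1: "(\<lambda>j. V (k - j) * neumann n (j - k0)) summable_on UNIV"
    using summable_on_reindex_bij_betw[OF bij, of ?h] hsum unfolding eq by simp
  have int1: "(\<Sum>\<^sub>\<infinity>j. V (k - j) * neumann n (j - k0)) = infsum ?h UNIV"
    using infsum_reindex_bij_betw[OF bij, of ?h] unfolding eq by simp
  have sum2: "(\<lambda>j. V (k - j) * (M / 2 ^ n)) summable_on UNIV"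
    by (intro summable_on_cmult_left summable_shifted_kernel)
  have int2: "(\<Sum>\<^sub>\<infinity>j. V (k - j) * (M / 2 ^ n)) \<le> 1 / 2 * (M / 2 ^ n)"
    using mult_right_mono[OF infsum_shifted_kernel[of k], of "M / 2 ^ n"] M
    by (subst infsum_cmult_left) (auto simp: summable_shifted_kernel)
  have "(\<Sum>\<^sub>\<infinity>j. V (k - j) * N j)
      \<le> (\<Sum>\<^sub>\<infinity>j. V (k - j) * neumann n (j - k0) + V (k - j) * (M / 2 ^ n))"
  proof (rule infsum_mono)
    have "(\<lambda>j. V (k - j) * M) summable_on UNIV"
      by (intro summable_on_cmult_left summable_shifted_kernel)
    then show "(\<lambda>j. V (k - j) * N j) summable_on UNIV"
      by (rule summable_on_comparison_test) (use V N in \<open>auto intro!: mult_left_mono\<close>)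
    show "(\<lambda>j. V (k - j) * neumann n (j - k0) + V (k - j) * (M / 2 ^ n)) summable_on UNIV"
      by (intro summable_on_add sum1 sum2)
    show "V (k - j) * N j \<le> V (k - j) * neumann n (j - k0) + V (k - j) * (M / 2 ^ n)" for j
      using V Suc[of j] unfolding distrib_left[symmetric] by (intro mult_left_mono)
  qed
  also have "\<dots> = infsum ?h UNIV + (\<Sum>\<^sub>\<infinity>j. V (k - j) * (M / 2 ^ n))"
    using infsum_add[OF sum1 sum2] int1 by simp
  finally have "(\<Sum>\<^sub>\<infinity>j. V (k - j) * N j) \<le> infsum ?h UNIV + M / 2 ^ Suc n"
    using int2 by simp
  then show ?case using sub[of k] by simp
qed

end

lemma convolution_majorant:
  fixes V g :: "'g::ab_group_add \<Rightarrow> real"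
  assumes s: "0 < s" "s \<le> 1"
    and V: "\<And>n. 0 \<le> V n" "\<And>F. finite F \<Longrightarrow> (\<Sum>n\<in>F. V n powr s) \<le> 1 / 2"
    and g: "\<And>n. 0 \<le> g n" "\<And>F. finite F \<Longrightarrow> (\<Sum>n\<in>F. g n powr s) \<le> G"
  shows "\<exists>W. (\<forall>n. 0 \<le> W n) \<and> (\<forall>F. finite F \<longrightarrow> (\<Sum>n\<in>F. W n powr s) \<le> 2 * G) \<and>
    (\<forall>N M k0. (\<forall>k. 0 \<le> N k \<and> N k \<le> M) \<longrightarrow>
       (\<forall>k. N k \<le> g (k - k0) + (\<Sum>\<^sub>\<infinity>j. V (k - j) * N j)) \<longrightarrow> (\<forall>k. N k \<le> W (k - k0)))"
proof -
  let ?W = "neumann V g"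
  note A = s V g
  have G: "0 \<le> G" using g(2)[of "{}"] by simp
  have nonneg: "0 \<le> ?W n k" for n k using neumann_bounds(1)[of s V g G] A by blast
  have sums: "finite F \<Longrightarrow> (\<Sum>k\<in>F. ?W n k powr s) \<le> 2 * G" for F n
    using neumann_bounds(2)[of s V g G F n] A by blast
  have "\<exists>L. (\<lambda>n. ?W n k) \<longlonglongrightarrow> L" for k
  proof -
    have "incseq (\<lambda>n. ?W n k)"
      using neumann_Suc_mono[of s V g G] A by (intro incseq_SucI) blast
    moreover have "?W n k \<le> (2 * G) powr (1 / s)" for n
    proof -
      have "(?W n k powr s) powr (1 / s) \<le> (2 * G) powr (1 / s)"
        using sums[of "{k}" n] s by (intro powr_mono2) auto
      then show ?thesis using s nonneg by (simp add: powr_powr)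
    qed
    ultimately show ?thesis by (metis incseq_convergent)
  qed
  then obtain W where W: "\<And>k. (\<lambda>n. ?W n k) \<longlonglongrightarrow> W k" by metis
  show ?thesis
  proof (intro exI[of _ W] conjI allI impI)
    show "0 \<le> W k" for k using LIMSEQ_le_const[OF W] nonneg by blast
    show "(\<Sum>n\<in>F. W n powr s) \<le> 2 * G" if F: "finite F" for F
    proof (rule LIMSEQ_le_const2)
      show "(\<lambda>n. \<Sum>k\<in>F. ?W n k powr s) \<longlonglongrightarrow> (\<Sum>n\<in>F. W n powr s)"
        using s nonneg by (intro tendsto_sum tendsto_powr' W tendsto_const) auto
    qed (use sums[OF F] in auto)
    fix N M k0 k
    assume N: "\<forall>k. 0 \<le> N k \<and> N k \<le> M"
      "\<forall>k. N k \<le> g (k - k0) + (\<Sum>\<^sub>\<infinity>j. V (k - j) * N j)"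
    have "(\<lambda>n. M / 2 ^ n) \<longlonglongrightarrow> 0" by real_asymp
    then have "(\<lambda>n. ?W n (k - k0) + M / 2 ^ n) \<longlonglongrightarrow> W (k - k0) + 0"
      by (intro tendsto_add W)
    moreover have "N k \<le> ?W n (k - k0) + M / 2 ^ n" for n
      using subsolution_le_neumann[of s V g G N M k0 k n] A N by blast
    ultimately show "N k \<le> W (k - k0)"
      using LIMSEQ_le_const by fastforce
  qed
qed

section \<open>Wiener amalgam envelopes and relatively separated sets\<close>

text \<open>
  For a continuous function the essential supremum over an open ball is a true upper bound: the
  points of the ball at which it is exceeded form an open null set, which is empty.
\<close>

lemma abs_le_local_Linf_norm:
  fixes H :: "'a::euclidean_space \<Rightarrow> real"
  assumes H: "H \<in> bcontfun" and y: "y \<in> ball x 1"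
  shows "\<bar>H y\<bar> \<le> enn2real (local_Linf_norm H x)"
proof (rule ccontr)
  assume contra: "\<not> \<bar>H y\<bar> \<le> enn2real (local_Linf_norm H x)"
  have cont: "continuous_on UNIV H" using H by (simp add: bcontfun_def)
  then have meas[measurable]: "H \<in> borel_measurable borel" by (rule borel_measurable_continuous_onI)
  obtain B where B: "\<And>z. \<bar>H z\<bar> \<le> B" using H by (auto simp: bcontfun_def bounded_iff)
  have "local_Linf_norm H x \<le> ennreal B"
    unfolding local_Linf_norm_def
    by (intro esssup_I measurable_restrict_space1) (auto intro!: AE_I2 ennreal_leI B)
  then have fin: "local_Linf_norm H x < \<infinity>" by (simp add: le_less_trans less_top)
  let ?U = "ball x 1 \<inter> {z. enn2real (local_Linf_norm H x) < \<bar>H z\<bar>}"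
  have "AE z in restrict_space lborel (ball x 1). ennreal (norm (H z)) \<le> local_Linf_norm H x"
    unfolding local_Linf_norm_def by (rule esssup_AE)
  then have "AE z in lborel. z \<in> ball x 1 \<longrightarrow> ennreal (norm (H z)) \<le> local_Linf_norm H x"
    by (subst (asm) AE_restrict_space_iff) auto
  then have "AE z in lborel. z \<notin> ?U"
  proof eventually_elim
    case (elim z)
    have "\<bar>H z\<bar> \<le> enn2real (local_Linf_norm H x)" if "z \<in> ball x 1"
      using enn2real_mono[of "ennreal \<bar>H z\<bar>" "local_Linf_norm H x"] elim that fin by simp
    then show ?case by auto
  qed
  moreover have openU: "open ?U"
    using cont by (intro open_Int open_ball open_Collect_less continuous_intros) auto
  ultimately have "?U \<in> null_sets lborel"
    by (subst AE_iff_null_sets) auto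
  then have null: "emeasure lborel ?U = 0" by (rule null_setsD1)
  have "y \<in> ?U" using y contra by auto
  then obtain e where e: "0 < e" "ball y e \<subseteq> ?U" using openU by (metis open_contains_ball)
  have "emeasure lborel (ball y e) \<le> emeasure lborel ?U"
    using e openU by (intro emeasure_mono) auto
  with null have "measure lborel (ball y e) = 0" by (simp add: measure_def)
  then show False using content_ball_pos[OF e(1), of y] by simp
qed

lemma local_Linf_norm_le:
  fixes H :: "'a::euclidean_space \<Rightarrow> real"
  assumes "continuous_on UNIV H" and "0 \<le> c" and "\<And>y. y \<in> ball x 1 \<Longrightarrow> \<bar>H y\<bar> \<le> c"
  shows "enn2real (local_Linf_norm H x) \<le> c"
proof -
  have [measurable]: "H \<in> borel_measurable borel"
    using assms(1) by (rule borel_measurable_continuous_onI)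
  have "local_Linf_norm H x \<le> ennreal c"
    unfolding local_Linf_norm_def using assms(3)
    by (intro esssup_I measurable_restrict_space1) (auto intro!: AE_I2 ennreal_leI simp: space_restrict_space)
  then show ?thesis using assms(2) by (intro enn2real_leI)
qed

text \<open>
  The majorant is \<open>y \<mapsto> (SUP z\<in>ball y 1. \<bar>H z\<bar>) powr p\<close>. It replaces the local norm in the definition of
  the amalgam space, whose measurability is not evident, by a lower semicontinuous function.
\<close>

lemma wiener_amalgam_majorant:
  fixes H :: "'a::euclidean_space \<Rightarrow> real"
  assumes p: "0 < p" and H: "H \<in> wiener_amalgam p"
  obtains g where "integrable lborel g" "\<And>y. 0 \<le> g y"
    "\<And>x y. dist x y < 1 \<Longrightarrow> \<bar>H x\<bar> powr p \<le> g y"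
proof -
  have bc: "H \<in> bcontfun" and int: "(\<integral>\<^sup>+ x. ennreal (enn2real (local_Linf_norm H x) powr p) \<partial>lborel) < \<infinity>"
    using H by (auto simp: wiener_amalgam_def)
  obtain B where B: "\<And>z. \<bar>H z\<bar> \<le> B" using bc by (auto simp: bcontfun_def bounded_iff)
  define S where "S y = (SUP z\<in>ball y 1. \<bar>H z\<bar>)" for y
  have bdd: "bdd_above ((\<lambda>z. \<bar>H z\<bar>) ` ball y 1)" for y using B by (auto intro!: bdd_aboveI2)
  have upper: "\<bar>H z\<bar> \<le> S y" if "dist z y < 1" for z y
    unfolding S_def using that bdd by (intro cSUP_upper) (auto simp: dist_commute)
  have S0: "0 \<le> S y" for y using upper[of y y] abs_ge_zero[of "H y"] by simp
  have "S \<in> borel_measurable borel"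
    unfolding borel_measurable_iff_greater
  proof
    fix a
    \<comment> \<open>Superlevel sets of \<open>S\<close> are unions of open balls.\<close>
    have "{w \<in> space borel. a < S w} = (\<Union>z\<in>{z. a < \<bar>H z\<bar>}. ball z 1)"
      unfolding S_def using bdd by (auto simp: less_cSUP_iff dist_commute)
    then show "{w \<in> space borel. a < S w} \<in> sets borel"
      by (simp add: borel_open open_UN)
  qed
  then have [measurable]: "S \<in> borel_measurable lborel" by simp
  show ?thesis
  proof (rule that[of "\<lambda>y. S y powr p"])
    show "integrable lborel (\<lambda>y. S y powr p)"
    proof (rule integrableI_nonneg)
      have "(\<integral>\<^sup>+ y. ennreal (S y powr p) \<partial>lborel) \<le> (\<integral>\<^sup>+ x. ennreal (enn2real (local_Linf_norm H x) powr p) \<partial>lborel)"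
        unfolding S_def using abs_le_local_Linf_norm[OF bc] p S0[unfolded S_def]
        by (intro nn_integral_mono ennreal_leI powr_mono2 cSUP_least) auto
      then show "(\<integral>\<^sup>+ y. ennreal (S y powr p) \<partial>lborel) < \<infinity>" using int by (rule le_less_trans)
    qed auto
    show "\<bar>H x\<bar> powr p \<le> S y powr p" if "dist x y < 1" for x y
      using upper[OF that] p by (intro powr_mono2) auto
  qed auto
qed

text \<open>
  Each sample \<open>f x\<close> is at most the average of \<open>h\<close> over the unit ball at \<open>x\<close>, and at most \<open>N\<close> of these
  balls contain a given point.
\<close>

lemma sum_samples_le_integral:
  fixes f h :: "'a::euclidean_space \<Rightarrow> real"
  assumes Q: "finite Q" "\<And>y. card (Q \<inter> ball y 1) \<le> N"
    and h: "integrable lborel h" "\<And>y. 0 \<le> h y"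
    and f: "\<And>x y. dist x y < 1 \<Longrightarrow> f x \<le> h y"
  shows "(\<Sum>x\<in>Q. f x) \<le> real N / measure lborel (ball (0::'a) 1) * (\<integral>y. h y \<partial>lborel)"
proof -
  let ?v = "measure lborel (ball (0::'a) 1)"
  have v: "0 < ?v" by (intro content_ball_pos) simp
  have v_eq: "measure lborel (ball x 1) = ?v" for x :: 'a
    by (simp add: content_ball)
  have int: "integrable lborel (\<lambda>y. indicator (ball x 1) y * h y)" for x
    using integrable_mult_indicator[OF _ h(1), of "ball x 1"] by simp
  have const: "integrable lborel (\<lambda>y. indicator (ball x 1) y * f x)"
    "(\<integral>y. indicator (ball x 1) y * f x \<partial>lborel) = f x * ?v" for x
    using v_eq[of x] emeasure_lborel_ball_finite[of x 1] by (simp_all add: mult.commute)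
  have "(\<Sum>x\<in>Q. f x) * ?v = (\<Sum>x\<in>Q. \<integral>y. indicator (ball x 1) y * f x \<partial>lborel)"
    by (simp only: sum_distrib_right const)
  also have "\<dots> \<le> (\<Sum>x\<in>Q. \<integral>y. indicator (ball x 1) y * h y \<partial>lborel)"
    using f by (intro sum_mono integral_mono int const(1)) (auto simp: indicator_def)
  also have "\<dots> = (\<integral>y. (\<Sum>x\<in>Q. indicator (ball x 1) y * h y) \<partial>lborel)"
    using int by (intro Bochner_Integration.integral_sum[symmetric])
  also have "\<dots> \<le> (\<integral>y. real N * h y \<partial>lborel)"
  proof (intro integral_mono)
    fix y
    have "(\<Sum>x\<in>Q. indicator (ball x 1) y :: real) = (\<Sum>x\<in>Q \<inter> ball y 1. 1)"
      using Q(1) by (intro sum.mono_neutral_cong_right) (auto simp: indicator_def dist_commute)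
    then have "(\<Sum>x\<in>Q. indicator (ball x 1) y :: real) \<le> real N" using Q(2)[of y] by simp
    then show "(\<Sum>x\<in>Q. indicator (ball x 1) y * h y) \<le> real N * h y"
      unfolding sum_distrib_right[symmetric] using h(2) by (intro mult_right_mono)
  qed (use int h in auto)
  also have "\<dots> = real N * (\<integral>y. h y \<partial>lborel)" by simp
  finally show ?thesis using v by (simp add: field_simps)
qed

lemma card_differences_in_ball:
  fixes P :: "'a::real_normed_vector set"
  assumes P: "\<And>x. finite (P \<inter> ball x 1) \<and> card (P \<inter> ball x 1) \<le> N" and G: "G \<subseteq> P"
  shows "card ((\<lambda>r. l - r) ` G \<inter> ball y 1) \<le> N" "card ((\<lambda>r. r - l) ` G \<inter> ball y 1) \<le> N"
proof -
  have "dist y (l - r) = dist (l - y) r" for r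
    using norm_minus_commute[of y "l - r"] by (simp add: dist_norm algebra_simps)
  then have "(\<lambda>r. l - r) ` G \<inter> ball y 1 \<subseteq> (\<lambda>r. l - r) ` (P \<inter> ball (l - y) 1)"
    using G by (auto intro!: imageI)
  then have "card ((\<lambda>r. l - r) ` G \<inter> ball y 1) \<le> card (P \<inter> ball (l - y) 1)"
    using P[of "l - y"] by (metis card_image_le card_mono finite_imageI le_trans)
  then show "card ((\<lambda>r. l - r) ` G \<inter> ball y 1) \<le> N" using P[of "l - y"] by linarith
  have "dist y (r - l) = dist (l + y) r" for r
    by (simp add: dist_norm algebra_simps)
  then have "(\<lambda>r. r - l) ` G \<inter> ball y 1 \<subseteq> (\<lambda>r. r - l) ` (P \<inter> ball (l + y) 1)"
    using G by (auto intro!: imageI)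
  then have "card ((\<lambda>r. r - l) ` G \<inter> ball y 1) \<le> card (P \<inter> ball (l + y) 1)"
    using P[of "l + y"] by (metis card_image_le card_mono finite_imageI le_trans)
  then show "card ((\<lambda>r. r - l) ` G \<inter> ball y 1) \<le> N" using P[of "l + y"] by linarith
qed

lemma separated_difference_sums:
  fixes P :: "'a::euclidean_space set" and f h :: "'a \<Rightarrow> real"
  assumes P: "\<And>x. finite (P \<inter> ball x 1) \<and> card (P \<inter> ball x 1) \<le> N"
    and h: "integrable lborel h" "\<And>y. 0 \<le> h y" "\<And>x y. dist x y < 1 \<Longrightarrow> f x \<le> h y"
    and G: "finite G" "G \<subseteq> P"
  shows "(\<Sum>r\<in>G. f (l - r)) \<le> real N / measure lborel (ball (0::'a) 1) * (\<integral>y. h y \<partial>lborel)"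
    and "(\<Sum>r\<in>G. f (r - l)) \<le> real N / measure lborel (ball (0::'a) 1) * (\<integral>y. h y \<partial>lborel)"
proof -
  have "(\<Sum>r\<in>G. f (l - r)) = (\<Sum>x\<in>(\<lambda>r. l - r) ` G. f x)"
    by (subst sum.reindex) (auto simp: inj_on_def)
  also have "\<dots> \<le> real N / measure lborel (ball (0::'a) 1) * (\<integral>y. h y \<partial>lborel)"
    using G card_differences_in_ball(1)[OF P G(2)] by (intro sum_samples_le_integral h) auto
  finally show "(\<Sum>r\<in>G. f (l - r)) \<le> real N / measure lborel (ball (0::'a) 1) * (\<integral>y. h y \<partial>lborel)" .
  have "(\<Sum>r\<in>G. f (r - l)) = (\<Sum>x\<in>(\<lambda>r. r - l) ` G. f x)"
    by (subst sum.reindex) (auto simp: inj_on_def)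
  also have "\<dots> \<le> real N / measure lborel (ball (0::'a) 1) * (\<integral>y. h y \<partial>lborel)"
    using G card_differences_in_ball(2)[OF P G(2)] by (intro sum_samples_le_integral h) auto
  finally show "(\<Sum>r\<in>G. f (r - l)) \<le> real N / measure lborel (ball (0::'a) 1) * (\<integral>y. h y \<partial>lborel)" .
qed

lemma relatively_separated_common_bound:
  assumes "relatively_separated I" "relatively_separated J"
  obtains N where "\<And>x. finite (I \<inter> ball x 1) \<and> card (I \<inter> ball x 1) \<le> N"
    "\<And>x. finite (J \<inter> ball x 1) \<and> card (J \<inter> ball x 1) \<le> N"
proof -
  obtain NI where NI: "\<And>x. finite (I \<inter> ball x 1) \<and> card (I \<inter> ball x 1) \<le> NI"
    using assms(1) unfolding relatively_separated_def by metis
  obtain NJ where NJ: "\<And>x. finite (J \<inter> ball x 1) \<and> card (J \<inter> ball x 1) \<le> NJ"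
    using assms(2) unfolding relatively_separated_def by metis
  show ?thesis using NI NJ by (intro that[of "max NI NJ"]) (auto simp: le_max_iff_disj)
qed

lemma conv_dominated_schur_bound:
  fixes I J :: "'a::euclidean_space set"
  assumes p: "0 < p" and I: "relatively_separated I" and J: "relatively_separated J"
    and A: "A \<in> conv_dominated p I J"
  obtains C where "0 \<le> C"
    "\<And>i G. i \<in> I \<Longrightarrow> finite G \<Longrightarrow> G \<subseteq> J \<Longrightarrow> (\<Sum>j\<in>G. norm (A i j) powr p) \<le> C"
    "\<And>j F. j \<in> J \<Longrightarrow> finite F \<Longrightarrow> F \<subseteq> I \<Longrightarrow> (\<Sum>i\<in>F. norm (A i j) powr p) \<le> C"
proof -
  obtain H where H: "H \<in> wiener_amalgam p" "\<And>i j. i \<in> I \<Longrightarrow> j \<in> J \<Longrightarrow> norm (A i j) \<le> H (i - j)"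
    using A by (auto simp: conv_dominated_def)
  obtain g where g: "integrable lborel g" "\<And>y. 0 \<le> g y"
    "\<And>x y. dist x y < 1 \<Longrightarrow> \<bar>H x\<bar> powr p \<le> g y"
    using wiener_amalgam_majorant[OF p H(1)] by metis
  obtain N where N: "\<And>x. finite (I \<inter> ball x 1) \<and> card (I \<inter> ball x 1) \<le> N"
    "\<And>x. finite (J \<inter> ball x 1) \<and> card (J \<inter> ball x 1) \<le> N"
    using relatively_separated_common_bound[OF I J] by metis
  let ?C = "real N / measure lborel (ball (0::'a) 1) * (\<integral>y. g y \<partial>lborel)"
  have entry: "norm (A i j) powr p \<le> \<bar>H (i - j)\<bar> powr p" if "i \<in> I" "j \<in> J" for i j
    using H(2)[OF that] p by (intro powr_mono2) auto
  show ?thesis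
  proof (rule that)
    show "0 \<le> ?C" using g by (intro mult_nonneg_nonneg integral_nonneg) auto
    show "(\<Sum>j\<in>G. norm (A i j) powr p) \<le> ?C" if "i \<in> I" "finite G" "G \<subseteq> J" for i G
    proof -
      have "(\<Sum>j\<in>G. norm (A i j) powr p) \<le> (\<Sum>j\<in>G. \<bar>H (i - j)\<bar> powr p)"
        using that entry by (intro sum_mono) auto
      also have "\<dots> \<le> ?C"
        by (rule separated_difference_sums(1)[OF N(2) g that(2,3)])
      finally show ?thesis .
    qed
    show "(\<Sum>i\<in>F. norm (A i j) powr p) \<le> ?C" if "j \<in> J" "finite F" "F \<subseteq> I" for j F
    proof -
      have "(\<Sum>i\<in>F. norm (A i j) powr p) \<le> (\<Sum>i\<in>F. \<bar>H (i - j)\<bar> powr p)"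
        using that entry by (intro sum_mono) auto
      also have "\<dots> \<le> ?C"
        by (rule separated_difference_sums(2)[OF N(1) g that(2,3)])
      finally show ?thesis .
    qed
  qed
qed

text \<open>
  Convolution dominated matrices act on \<open>\<ell>\<^sup>p\<close> for every \<open>p \<ge> q\<close>, and the sums defining this action
  converge absolutely.
\<close>

lemma conv_dominated_operator:
  fixes I J :: "'a::euclidean_space set"
  assumes q: "0 < q" "q \<le> 1" "ennreal q \<le> p" and I: "relatively_separated I" and J: "relatively_separated J"
    and A: "A \<in> conv_dominated q I J" and c: "c \<in> lp_space p J"
  shows "\<And>i. i \<in> I \<Longrightarrow> (\<lambda>j. norm (A i j) * norm (c j)) summable_on J"
    and "matrix_operator I J A c \<in> lp_space p I"
proof -
  have p: "0 < p" and qr: "q \<le> subadd_exp p" using subadd_exp_ge[OF q] by auto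
  obtain C where C: "0 \<le> C"
    "\<And>i G. i \<in> I \<Longrightarrow> finite G \<Longrightarrow> G \<subseteq> J \<Longrightarrow> (\<Sum>j\<in>G. norm (A i j) powr q) \<le> C"
    "\<And>j F. j \<in> J \<Longrightarrow> finite F \<Longrightarrow> F \<subseteq> I \<Longrightarrow> (\<Sum>i\<in>F. norm (A i j) powr q) \<le> C"
    using conv_dominated_schur_bound[OF q(1) I J A] by metis
  let ?V = "C powr (subadd_exp p / q)" and ?N = "lp_norm p c powr subadd_exp p"
  note bs = block_schur[where p = p and I = I and J = J and m = "\<lambda>i j. norm (A i j)"
      and x = "\<lambda>j. norm (c j)" and b = "\<lambda>_. ()" and V = "\<lambda>_. ?V" and N = "\<lambda>_. ?N"]
  have rows: "(\<Sum>j\<in>G. norm (A i j) powr subadd_exp p) \<le> ?V"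
    if "i \<in> I" "finite G" "G \<subseteq> {j\<in>J. () = k}" for i k G
    using that q qr by (intro sum_powr_exponent_mono C) auto
  have cols: "(\<Sum>i\<in>F. norm (A i j) powr subadd_exp p) \<le> ?V"
    if "j \<in> J" "finite F" "F \<subseteq> I" for j F
    using that q qr by (intro sum_powr_exponent_mono C) auto
  have blocks: "lp_le p {j\<in>J. () = k} (\<lambda>j. norm (c j)) ?N" for k
    by (rule lp_le_lp_norm[OF p c])
  show summable: "(\<lambda>j. norm (A i j) * norm (c j)) summable_on J" if "i \<in> I" for i
    by (rule bs(1)[OF p _ _ rows cols _ _ blocks _ that]) auto
  have le: "lp_le p I (\<lambda>i. \<Sum>\<^sub>\<infinity>j\<in>J. norm (A i j) * norm (c j)) (\<Sum>\<^sub>\<infinity>k::unit. ?V * ?N)"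
    by (rule bs(2)[OF p _ _ rows cols _ _ blocks]) auto
  show "matrix_operator I J A c \<in> lp_space p I"
  proof (rule lp_space_I[OF p])
    show "lp_le p I (\<lambda>i. norm (matrix_operator I J A c i)) (\<Sum>\<^sub>\<infinity>k::unit. ?V * ?N)"
    proof (rule lp_le_mono[OF p le])
      show "norm (matrix_operator I J A c i) \<le> (\<Sum>\<^sub>\<infinity>j\<in>J. norm (A i j) * norm (c j))" if "i \<in> I" for i
        using norm_infsum_bound[of "\<lambda>j. A i j * c j" J] summable[OF that] that
        by (simp add: matrix_operator_def norm_mult)
    qed auto
  qed (auto simp: matrix_operator_def)
qed

text \<open>
  Associativity \<open>A (B d) = (A B) d\<close>. The matrix of moduli of \<open>B\<close> is convolution dominated too, so
  it maps \<open>\<bar>d\<bar>\<close> into \<open>\<ell>\<^sup>p\<close>; this gives the absolute convergence of the double sum.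
\<close>

lemma matrix_operator_product:
  fixes \<Lambda> \<Gamma> :: "'a::euclidean_space set"
  assumes q: "0 < q" "q \<le> 1" "ennreal q \<le> p"
    and \<Lambda>: "relatively_separated \<Lambda>" and \<Gamma>: "relatively_separated \<Gamma>"
    and A: "A \<in> conv_dominated q \<Lambda> \<Gamma>" and B: "B \<in> conv_dominated q \<Gamma> \<Lambda>"
    and d: "d \<in> lp_space p \<Lambda>" and l: "l \<in> \<Lambda>"
  shows "matrix_operator \<Lambda> \<Gamma> A (matrix_operator \<Gamma> \<Lambda> B d) l
    = (\<Sum>\<^sub>\<infinity>l'\<in>\<Lambda>. (\<Sum>\<^sub>\<infinity>r\<in>\<Gamma>. A l r * B r l') * d l')"
proof -
  have p: "0 < p" using subadd_exp_ge[OF q] by auto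
  define B' where "B' r l' = complex_of_real (norm (B r l'))" for r l'
  define d' where "d' l' = complex_of_real (norm (d l'))" for l'
  have B': "B' \<in> conv_dominated q \<Gamma> \<Lambda>" using B by (simp add: conv_dominated_def B'_def)
  have d': "d' \<in> lp_space p \<Lambda>" using d by (simp add: lp_space_eq_lp_le[OF p] d'_def)
  let ?f = "\<lambda>(r, l'). A l r * (B r l' * d l')"
  have "(\<lambda>x. norm (?f x)) summable_on \<Gamma> \<times> \<Lambda>"
    unfolding Infinite_Sum.abs_summable_on_Sigma_iff
  proof (intro conjI ballI)
    have inner: "(\<Sum>\<^sub>\<infinity>l'\<in>\<Lambda>. norm (?f (r, l'))) = norm (A l r) * norm (matrix_operator \<Gamma> \<Lambda> B' d' r)"
      if r: "r \<in> \<Gamma>" for r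
    proof -
      have "matrix_operator \<Gamma> \<Lambda> B' d' r = of_real (\<Sum>\<^sub>\<infinity>l'\<in>\<Lambda>. norm (B r l') * norm (d l'))"
        using r infsumI[OF has_sum_of_real[OF has_sum_infsum[OF conv_dominated_operator(1)[OF q \<Gamma> \<Lambda> B d r]]]]
        by (simp add: matrix_operator_def B'_def d'_def)
      then show ?thesis
        by (simp add: norm_mult infsum_cmult_right' infsum_nonneg)
    qed
    show "(\<lambda>l'. norm (?f (r, l'))) summable_on \<Lambda>" if "r \<in> \<Gamma>" for r
      using conv_dominated_operator(1)[OF q \<Gamma> \<Lambda> B d that]
      by (auto simp: norm_mult intro!: summable_on_cmult_right)
    show "(\<lambda>r. norm (\<Sum>\<^sub>\<infinity>l'\<in>\<Lambda>. norm (?f (r, l')))) summable_on \<Gamma>"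
    proof -
      have "(\<lambda>r. norm (A l r) * norm (matrix_operator \<Gamma> \<Lambda> B' d' r)) summable_on \<Gamma>"
        by (rule conv_dominated_operator(1)[OF q \<Lambda> \<Gamma> A conv_dominated_operator(2)[OF q \<Gamma> \<Lambda> B' d'] l])
      then have "(\<lambda>r. \<Sum>\<^sub>\<infinity>l'\<in>\<Lambda>. norm (?f (r, l'))) summable_on \<Gamma>"
        using inner by (subst summable_on_cong) auto
      then show ?thesis by (simp add: infsum_nonneg)
    qed
  qed
  then have sum: "?f summable_on \<Gamma> \<times> \<Lambda>" by (rule abs_summable_summable)
  have "matrix_operator \<Lambda> \<Gamma> A (matrix_operator \<Gamma> \<Lambda> B d) l = (\<Sum>\<^sub>\<infinity>r\<in>\<Gamma>. \<Sum>\<^sub>\<infinity>l'\<in>\<Lambda>. A l r * (B r l' * d l'))"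
    using l by (simp add: matrix_operator_def infsum_cmult_right' cong: infsum_cong)
  also have "\<dots> = (\<Sum>\<^sub>\<infinity>l'\<in>\<Lambda>. \<Sum>\<^sub>\<infinity>r\<in>\<Gamma>. A l r * (B r l' * d l'))"
    using sum by (rule infsum_swap_banach)
  also have "\<dots> = (\<Sum>\<^sub>\<infinity>l'\<in>\<Lambda>. (\<Sum>\<^sub>\<infinity>r\<in>\<Gamma>. A l r * B r l') * d l')"
    by (simp add: infsum_cmult_left'[symmetric] mult.assoc)
  finally show ?thesis .
qed

section \<open>Lattice cells and envelopes from lattice sequences\<close>

text \<open>
  The lattice is indexed by the additive group \<open>int ^ 'd\<close> rather than by a subset of \<open>real ^ 'd\<close>, so that
  lattice sums range over a whole type and can be translated freely.
\<close>

definition lattice_point :: "int ^ 'd \<Rightarrow> real ^ 'd" where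
  "lattice_point k = (\<chi> i. of_int (k $ i))"

definition vec_floor :: "real ^ 'd \<Rightarrow> int ^ 'd" where
  "vec_floor x = (\<chi> i. \<lfloor>x $ i\<rfloor>)"

text \<open>
  The \<open>\<ell>\<^sup>1\<close> diameter of a unit cell, a convenient upper bound for the Euclidean one.
\<close>

abbreviation cell_diameter :: "'d::finite itself \<Rightarrow> real" where
  "cell_diameter _ \<equiv> real CARD('d)"

lemma lattice_point_diff: "lattice_point (k - j) = lattice_point k - lattice_point j"
  by (simp add: lattice_point_def vec_eq_iff)

lemma norm_diff_vec_floor: "norm (x - lattice_point (vec_floor x)) \<le> cell_diameter TYPE('d)"
  for x :: "real ^ 'd"
proof -
  have "norm (x - lattice_point (vec_floor x)) \<le> (\<Sum>i\<in>UNIV. \<bar>(x - lattice_point (vec_floor x)) $ i\<bar>)"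
    by (rule norm_le_l1_cart)
  also have "\<dots> \<le> (\<Sum>i\<in>(UNIV :: 'd set). 1)"
    by (intro sum_mono) (simp add: lattice_point_def vec_floor_def abs_le_iff, linarith)
  finally show ?thesis by simp
qed

lemma finite_lattice_points_near_0: "finite {n :: int ^ 'd. norm (lattice_point n) \<le> D}"
proof (rule finite_subset)
  let ?B = "PiE UNIV (\<lambda>_ :: 'd. {- \<lceil>D\<rceil>..\<lceil>D\<rceil>})"
  show "finite ((\<lambda>f. \<chi> i. f i) ` ?B)" by (intro finite_imageI finite_PiE) auto
  show "{n :: int ^ 'd. norm (lattice_point n) \<le> D} \<subseteq> (\<lambda>f. \<chi> i. f i) ` ?B"
  proof
    fix n :: "int ^ 'd" assume n: "n \<in> {n. norm (lattice_point n) \<le> D}"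
    have "\<bar>n $ i\<bar> \<le> \<lceil>D\<rceil>" for i
    proof -
      have "\<bar>real_of_int (n $ i)\<bar> \<le> D"
        using n component_le_norm_cart[of "lattice_point n" i] by (simp add: lattice_point_def)
      then show ?thesis by linarith
    qed
    then have "(\<lambda>i. n $ i) \<in> ?B" by (auto simp: abs_le_iff) (metis minus_le_iff)
    moreover have "n = (\<chi> i. n $ i)" by (simp add: vec_eq_iff)
    ultimately show "n \<in> (\<lambda>f. \<chi> i. f i) ` ?B" by blast
  qed
qed

text \<open>
  Translation by the integer part of \<open>y\<close> reduces to points near the origin.
\<close>

lemma card_lattice_points_near:
  fixes y :: "real ^ 'd"
  assumes F: "finite F"
  shows "card {n\<in>F. norm (y - lattice_point n) \<le> D}
    \<le> card {n :: int ^ 'd. norm (lattice_point n) \<le> D + cell_diameter TYPE('d)}"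
proof -
  let ?S = "{n\<in>F. norm (y - lattice_point n) \<le> D}"
  have "(\<lambda>n. n - vec_floor y) ` ?S \<subseteq> {n. norm (lattice_point n) \<le> D + cell_diameter TYPE('d)}"
  proof clarify
    fix n assume "norm (y - lattice_point n) \<le> D"
    moreover have "lattice_point (n - vec_floor y) = (y - lattice_point (vec_floor y)) - (y - lattice_point n)"
      by (simp add: lattice_point_diff)
    ultimately show "norm (lattice_point (n - vec_floor y)) \<le> D + cell_diameter TYPE('d)"
      using norm_triangle_ineq4[of "y - lattice_point (vec_floor y)" "y - lattice_point n"]
        norm_diff_vec_floor[of y] by simp
  qed
  then have "card ((\<lambda>n. n - vec_floor y) ` ?S) \<le> card {n :: int ^ 'd. norm (lattice_point n) \<le> D + cell_diameter TYPE('d)}"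
    by (intro card_mono finite_lattice_points_near_0)
  then show ?thesis by (subst (asm) card_image) (auto simp: inj_on_def)
qed

text \<open>
  The envelope is the supremum of the bumps of height \<open>W n\<close> around \<open>R * n\<close>. Since the bumps have a
  common Lipschitz constant, it is Lipschitz. A bump is \<open>1\<close> within distance \<open>2 d R\<close> of its centre,
  because two points differ from the corners of their cells by at most \<open>d R\<close> each. Only boundedly
  many bumps meet a unit ball, whence the amalgam norm is controlled by the sum of \<open>W n powr q\<close>.
\<close>

lemma lattice_envelope:
  fixes W :: "int ^ 'd \<Rightarrow> real"
  assumes q: "0 < q" and R: "0 < R" and W: "\<And>n. 0 \<le> W n" "\<And>F. finite F \<Longrightarrow> (\<Sum>n\<in>F. W n powr q) \<le> C"
  obtains H where "H \<in> wiener_amalgam q"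
    "\<And>l r. W (vec_floor (l /\<^sub>R R) - vec_floor (r /\<^sub>R R)) \<le> H (l - r)"
proof -
  let ?d = "cell_diameter TYPE('d)"
  define bump where "bump n x = max 0 (min 1 (2 * ?d + 1 - norm (x /\<^sub>R R - lattice_point n)))" for n and x :: "real ^ 'd"
  have bump01: "0 \<le> bump n x" "bump n x \<le> 1" for n x by (auto simp: bump_def)
  define B where "B = C powr (1 / q)"
  have W_le: "W n \<le> B" for n
  proof -
    have "(W n powr q) powr (1 / q) \<le> C powr (1 / q)"
      using W(2)[of "{n}"] q by (intro powr_mono2) auto
    then show ?thesis using q W by (simp add: powr_powr B_def)
  qed
  have B: "0 \<le> B" by (simp add: B_def)
  have bump_diff: "bump n x \<le> bump n y + norm (x - y) / R" for n x y
  proof -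
    have "norm (y /\<^sub>R R - lattice_point n) \<le> norm (x /\<^sub>R R - lattice_point n) + norm ((y - x) /\<^sub>R R)"
      using norm_triangle_ineq[of "x /\<^sub>R R - lattice_point n" "(y - x) /\<^sub>R R"]
      by (simp add: scaleR_diff_right)
    also have "norm ((y - x) /\<^sub>R R) = norm (x - y) / R"
      using R by (simp add: divide_inverse mult.commute norm_minus_commute)
    finally have *: "norm (y /\<^sub>R R - lattice_point n) \<le> norm (x /\<^sub>R R - lattice_point n) + norm (x - y) / R" .
    have "0 \<le> norm (x - y) / R" using R by simp
    with * show ?thesis by (auto simp: bump_def max_def min_def)
  qed
  define H where "H x = (SUP n. W n * bump n x)" for x
  have term_le: "W n * bump n x \<le> B" for n x
    using mult_mono[OF W_le[of n] bump01(2)[of n x]] bump01 B by simp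
  have bdd: "bdd_above (range (\<lambda>n. W n * bump n x))" for x
    using term_le by (auto intro!: bdd_aboveI2)
  have H_upper: "W n * bump n x \<le> H x" for n x
    unfolding H_def using bdd by (intro cSUP_upper) auto
  have H_nonneg: "0 \<le> H x" for x
    using H_upper[of 0 x] W bump01 mult_nonneg_nonneg by (meson order_trans)
  have H_le_B: "H x \<le> B" for x unfolding H_def using term_le by (intro cSUP_least) auto
  have H_diff: "H x \<le> H y + B / R * norm (x - y)" for x y
    unfolding H_def[of x]
  proof (rule cSUP_least)
    fix n
    have "W n * bump n x \<le> W n * bump n y + W n * (norm (x - y) / R)"
      unfolding distrib_left[symmetric] using bump_diff W by (intro mult_left_mono)
    also have "\<dots> \<le> H y + B * (norm (x - y) / R)"
      using W_le R by (intro add_mono H_upper mult_right_mono) auto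
    finally show "W n * bump n x \<le> H y + B / R * norm (x - y)" by simp
  qed auto
  have cont: "continuous_on UNIV H"
  proof (rule lipschitz_on_continuous_on)
    show "(B / R)-lipschitz_on UNIV H"
    proof (rule lipschitz_onI)
      show "dist (H x) (H y) \<le> B / R * dist x y" for x y
        using H_diff[of x y] H_diff[of y x] by (simp add: dist_norm abs_le_iff norm_minus_commute)
    qed (use B R in auto)
  qed
  define \<rho> where "\<rho> = R * (2 * ?d + 1) + 1"
  define E where "E n = cball (R *\<^sub>R lattice_point n) \<rho>" for n :: "int ^ 'd"
  have [measurable]: "E n \<in> sets borel" for n by (simp add: E_def)
  \<comment> \<open>The integral of \<open>T\<close> is the sum of the volumes of balls of equal radius, weighted by \<open>W n powr q\<close>.\<close>
  define T where "T x = (\<integral>\<^sup>+ n. ennreal (W n powr q) * indicator (E n) x \<partial>count_space UNIV)" for x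
  have local_le: "ennreal (enn2real (local_Linf_norm H x) powr q) \<le> T x" for x
  proof (cases "T x = \<infinity>")
    case False
    define t where "t = enn2real (T x)"
    have t: "T x = ennreal t" "0 \<le> t" using False by (auto simp: t_def less_top)
    have W_pow: "W n powr q \<le> t" if "x \<in> E n" for n
    proof -
      have "ennreal (W n powr q) * indicator (E n) x \<le> T x"
        unfolding T_def by (rule nn_integral_ge_point) simp
      then show ?thesis using that t by simp
    qed
    have "enn2real (local_Linf_norm H x) \<le> t powr (1 / q)"
    proof (rule local_Linf_norm_le[OF cont])
      fix y assume y: "y \<in> ball x 1"
      have "H y \<le> t powr (1 / q)"
        unfolding H_def
      proof (rule cSUP_least)
        fix n
        show "W n * bump n y \<le> t powr (1 / q)"
        proof (cases "bump n y = 0")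
          case False
          then have near: "norm (y /\<^sub>R R - lattice_point n) \<le> 2 * ?d + 1"
            by (auto simp: bump_def max_def split: if_splits)
          have "y - R *\<^sub>R lattice_point n = R *\<^sub>R (y /\<^sub>R R - lattice_point n)"
            using R by (simp add: scaleR_diff_right)
          then have "norm (y - R *\<^sub>R lattice_point n) = R * norm (y /\<^sub>R R - lattice_point n)"
            using R by (simp only: norm_scaleR abs_of_pos)
          also have "\<dots> \<le> R * (2 * ?d + 1)"
            using R near by (intro mult_left_mono) auto
          finally have "dist (R *\<^sub>R lattice_point n) y \<le> R * (2 * ?d + 1)"
            by (simp add: dist_norm norm_minus_commute)
          moreover have "dist (R *\<^sub>R lattice_point n) x \<le> dist (R *\<^sub>R lattice_point n) y + dist y x"
            by (rule dist_triangle)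
          ultimately have "x \<in> E n" using y by (simp add: E_def \<rho>_def dist_commute)
          have "W n * bump n y \<le> W n * 1" using bump01 W by (intro mult_left_mono) auto
          also have "\<dots> = (W n powr q) powr (1 / q)" using q W by (simp add: powr_powr)
          also have "\<dots> \<le> t powr (1 / q)" using q W_pow[OF \<open>x \<in> E n\<close>] by (intro powr_mono2) auto
          finally show ?thesis .
        qed simp
      qed auto
      then show "\<bar>H y\<bar> \<le> t powr (1 / q)" using H_nonneg[of y] by simp
    qed auto
    then have "enn2real (local_Linf_norm H x) powr q \<le> (t powr (1 / q)) powr q"
      using q by (intro powr_mono2) auto
    then show ?thesis using q t by (simp add: powr_powr ennreal_leI)
  qed auto
  have "(\<integral>\<^sup>+ x. ennreal (enn2real (local_Linf_norm H x) powr q) \<partial>lborel) \<le> (\<integral>\<^sup>+ x. T x \<partial>lborel)"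
    by (intro nn_integral_mono local_le)
  also have "\<dots> = (\<integral>\<^sup>+ n. (\<integral>\<^sup>+ x. ennreal (W n powr q) * indicator (E n) x \<partial>lborel) \<partial>count_space UNIV)"
    unfolding T_def by (intro nn_integral_count_space_nn_integral countableI_type) measurable
  also have "\<dots> = (\<integral>\<^sup>+ n. ennreal (W n powr q) * emeasure lborel (cball (0 :: real ^ 'd) \<rho>) \<partial>count_space (UNIV :: (int ^ 'd) set))"
  proof (intro nn_integral_cong)
    fix n :: "int ^ 'd"
    have "0 \<le> \<rho>" using R by (simp add: \<rho>_def)
    then have "emeasure lborel (E n) = emeasure lborel (cball (0 :: real ^ 'd) \<rho>)"
      by (simp add: E_def emeasure_cball)
    then show "(\<integral>\<^sup>+ x. ennreal (W n powr q) * indicator (E n) x \<partial>lborel)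
        = ennreal (W n powr q) * emeasure lborel (cball (0 :: real ^ 'd) \<rho>)"
      using nn_integral_cmult_indicator[of "E n" lborel "ennreal (W n powr q)"] by simp
  qed
  also have "\<dots> = (\<integral>\<^sup>+ n. ennreal (W n powr q) \<partial>count_space UNIV) * emeasure lborel (cball (0 :: real ^ 'd) \<rho>)"
    by (intro nn_integral_multc) simp
  also have "\<dots> < \<infinity>"
  proof -
    have "(\<lambda>n. W n powr q) summable_on UNIV" using W by (intro summable_onI_nonneg) auto
    then have "integrable (count_space UNIV) (\<lambda>n. W n powr q)"
      unfolding abs_summable_on_def[symmetric] by (subst abs_summable_equivalent[symmetric]) simp
    then have "(\<integral>\<^sup>+ n. ennreal (W n powr q) \<partial>count_space UNIV) < \<infinity>"
      by (simp add: integrable_iff_bounded)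
    then show ?thesis using emeasure_lborel_cball_finite[of "0 :: real ^ 'd" \<rho>]
      by (simp add: ennreal_mult_less_top)
  qed
  finally have "H \<in> wiener_amalgam q"
    using cont H_nonneg H_le_B
    by (auto simp: wiener_amalgam_def bcontfun_def bounded_iff intro!: exI[of _ B])
  moreover have "W (vec_floor (l /\<^sub>R R) - vec_floor (r /\<^sub>R R)) \<le> H (l - r)" for l r
  proof -
    let ?n = "vec_floor (l /\<^sub>R R) - vec_floor (r /\<^sub>R R)"
    have split: "(l - r) /\<^sub>R R - lattice_point ?n
        = (l /\<^sub>R R - lattice_point (vec_floor (l /\<^sub>R R))) - (r /\<^sub>R R - lattice_point (vec_floor (r /\<^sub>R R)))"
      by (simp add: lattice_point_diff scaleR_diff_right)
    have "norm ((l - r) /\<^sub>R R - lattice_point ?n) \<le> 2 * ?d"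
      unfolding split
      using norm_triangle_ineq4[of "l /\<^sub>R R - lattice_point (vec_floor (l /\<^sub>R R))"
          "r /\<^sub>R R - lattice_point (vec_floor (r /\<^sub>R R))"]
        norm_diff_vec_floor[of "l /\<^sub>R R"] norm_diff_vec_floor[of "r /\<^sub>R R"] by linarith
    then have "bump ?n (l - r) = 1" by (simp add: bump_def)
    then show ?thesis using H_upper[of ?n "l - r"] by simp
  qed
  ultimately show ?thesis by (rule that)
qed

section \<open>Windows and the commutator kernel\<close>

text \<open>
  The window equals \<open>1\<close> on the cell of \<open>k\<close> and varies on the scale \<open>R\<close>.
\<close>

definition window :: "real \<Rightarrow> int ^ 'd \<Rightarrow> real ^ 'd \<Rightarrow> real" where
  "window R k x = max 0 (min 1 (cell_diameter TYPE('d) + 1 - norm (x /\<^sub>R R - lattice_point k)))"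

lemma window_bounds: "0 \<le> window R k x" "window R k x \<le> 1"
  by (auto simp: window_def)

lemma window_eq_1: "window R (vec_floor (x /\<^sub>R R)) x = 1"
  using norm_diff_vec_floor[of "x /\<^sub>R R"] by (simp add: window_def)

lemma window_nonzero: "window R k x \<noteq> 0 \<Longrightarrow> norm (x /\<^sub>R R - lattice_point k) < cell_diameter TYPE('d) + 1"
  for x :: "real ^ 'd"
  by (auto simp: window_def max_def split: if_splits)

lemma window_lipschitz:
  assumes "0 < R"
  shows "\<bar>window R k x - window R k y\<bar> \<le> min 1 (norm (x - y) / R)"
proof -
  \<comment> \<open>The norm in the definition of the window is 1-Lipschitz, and so is truncation.\<close>
  have "\<bar>norm (x /\<^sub>R R - lattice_point k) - norm (y /\<^sub>R R - lattice_point k)\<bar>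
      \<le> norm ((x /\<^sub>R R - lattice_point k) - (y /\<^sub>R R - lattice_point k))"
    by (rule norm_triangle_ineq3)
  also have "(x /\<^sub>R R - lattice_point k) - (y /\<^sub>R R - lattice_point k) = (x - y) /\<^sub>R R"
    by (simp add: scaleR_diff_right)
  also have "norm \<dots> = norm (x - y) / R" using assms by (simp add: divide_inverse mult.commute)
  finally show ?thesis
    by (auto simp: window_def max_def min_def)
qed

text \<open>
  A bound for the \<open>q\<close>-th power of the commutator entries at \<open>x = l - r\<close>, where \<open>n\<close> is the offset between the
  window and the cell of \<open>r\<close>. If \<open>n\<close> is far from \<open>0\<close>, then the window vanishes at \<open>r\<close>, and the entry
  can be nonzero only if \<open>l\<close> lies in its support, which forces \<open>x\<close> to be near \<open>R * n\<close>.
\<close>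

definition commutator_profile :: "real \<Rightarrow> real \<Rightarrow> (real ^ 'd \<Rightarrow> real) \<Rightarrow> int ^ 'd \<Rightarrow> real ^ 'd \<Rightarrow> real" where
  "commutator_profile q R H n x =
     (if norm (lattice_point n) \<le> 2 * cell_diameter TYPE('d) + 1
       \<or> norm (x /\<^sub>R R - lattice_point n) \<le> 2 * cell_diameter TYPE('d) + 1
      then \<bar>H x\<bar> powr q * min 1 (norm x / R) powr q else 0)"

lemma commutator_entry_le_profile:
  fixes H :: "real ^ 'd \<Rightarrow> real"
  assumes q: "0 < q" and R: "0 < R" and a: "0 \<le> a" "a \<le> H (l - r)"
  shows "(a * \<bar>window R k r - window R k l\<bar>) powr q
    \<le> commutator_profile q R H (k - vec_floor (r /\<^sub>R R)) (l - r)"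
proof (cases "window R k r = window R k l")
  case True
  then show ?thesis using q by (simp add: commutator_profile_def)
next
  case False
  define j where "j = vec_floor (r /\<^sub>R R)"
  have rj: "norm (r /\<^sub>R R - lattice_point j) \<le> cell_diameter TYPE('d)"
    unfolding j_def by (rule norm_diff_vec_floor)
  have "norm (lattice_point (k - j)) \<le> 2 * cell_diameter TYPE('d) + 1
      \<or> norm ((l - r) /\<^sub>R R - lattice_point (k - j)) \<le> 2 * cell_diameter TYPE('d) + 1"
  proof (cases "window R k r = 0")
    case True
    then have "norm (l /\<^sub>R R - lattice_point k) < cell_diameter TYPE('d) + 1"
      using False by (intro window_nonzero) auto
    moreover have "(l - r) /\<^sub>R R - lattice_point (k - j)
        = (l /\<^sub>R R - lattice_point k) - (r /\<^sub>R R - lattice_point j)"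
      by (simp add: lattice_point_diff scaleR_diff_right)
    ultimately show ?thesis
      using norm_triangle_ineq4[of "l /\<^sub>R R - lattice_point k" "r /\<^sub>R R - lattice_point j"] rj by simp
  next
    case False
    then have "norm (r /\<^sub>R R - lattice_point k) < cell_diameter TYPE('d) + 1"
      by (rule window_nonzero)
    moreover have "lattice_point (k - j) = (r /\<^sub>R R - lattice_point j) - (r /\<^sub>R R - lattice_point k)"
      by (simp add: lattice_point_diff)
    ultimately show ?thesis
      using norm_triangle_ineq4[of "r /\<^sub>R R - lattice_point j" "r /\<^sub>R R - lattice_point k"] rj by simp
  qed
  then have "commutator_profile q R H (k - j) (l - r)
      = (\<bar>H (l - r)\<bar> * min 1 (norm (l - r) / R)) powr q"
    by (simp add: commutator_profile_def powr_mult)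
  moreover have "(a * \<bar>window R k r - window R k l\<bar>) powr q \<le> (\<bar>H (l - r)\<bar> * min 1 (norm (l - r) / R)) powr q"
    using window_lipschitz[OF R, of k r l] a q
    by (intro powr_mono2 mult_mono) (auto simp: norm_minus_commute)
  ultimately show ?thesis by (simp add: j_def)
qed

text \<open>
  Let \<open>g\<close> be an integrable majorant of \<open>\<bar>H\<bar> powr q\<close>. The row and column sums of the profile with offset \<open>n\<close>
  are bounded by a multiple of the integral of \<open>g y * min 1 ((norm y + 1) / R) powr q\<close> over a
  region that depends on \<open>n\<close>. For small \<open>n\<close> it is the whole space, but the number of such \<open>n\<close> does not depend
  on \<open>R\<close>; the other regions are balls around \<open>R * n\<close> that overlap boundedly often. So the total over \<open>n\<close> is a multiple of the integral
  over the whole space, which tends to \<open>0\<close> as \<open>R\<close> grows by dominated convergence.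
\<close>

lemma commutator_kernel:
  fixes \<Lambda> \<Gamma> :: "(real ^ 'd) set" and H :: "real ^ 'd \<Rightarrow> real"
  assumes q: "0 < q" and \<Lambda>: "relatively_separated \<Lambda>" and \<Gamma>: "relatively_separated \<Gamma>"
    and H: "H \<in> wiener_amalgam q" and \<eta>: "0 < \<eta>"
  obtains R U where "1 \<le> R" "\<And>n. 0 \<le> U n" "\<And>F. finite F \<Longrightarrow> (\<Sum>n\<in>F. U n) \<le> \<eta>"
    "\<And>n l G. finite G \<Longrightarrow> G \<subseteq> \<Gamma> \<Longrightarrow> (\<Sum>r\<in>G. commutator_profile q R H n (l - r)) \<le> U n"
    "\<And>n r F. finite F \<Longrightarrow> F \<subseteq> \<Lambda> \<Longrightarrow> (\<Sum>l\<in>F. commutator_profile q R H n (l - r)) \<le> U n"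
proof -
  let ?d = "cell_diameter TYPE('d)"
  obtain g where g: "integrable lborel g" "\<And>y. 0 \<le> g y"
    "\<And>x y. dist x y < 1 \<Longrightarrow> \<bar>H x\<bar> powr q \<le> g y"
    using wiener_amalgam_majorant[OF q H] by metis
  have [measurable]: "g \<in> borel_measurable borel"
    using g(1) by (simp add: borel_measurable_integrable)
  obtain N where N: "\<And>x. finite (\<Lambda> \<inter> ball x 1) \<and> card (\<Lambda> \<inter> ball x 1) \<le> N"
    "\<And>x. finite (\<Gamma> \<inter> ball x 1) \<and> card (\<Gamma> \<inter> ball x 1) \<le> N"
    using relatively_separated_common_bound[OF \<Lambda> \<Gamma>] by metis
  define \<kappa> where "\<kappa> = real N / measure lborel (ball (0 :: real ^ 'd) 1)"
  have \<kappa>: "0 \<le> \<kappa>" by (simp add: \<kappa>_def)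
  define w where "w R y = g y * min 1 ((norm y + 1) / R) powr q" for R and y :: "real ^ 'd"
  have w_bounds: "0 \<le> w R y" "w R y \<le> g y" if "0 < R" for R y
  proof -
    have "min 1 ((norm y + 1) / R) powr q \<le> 1 powr q"
      using that q by (intro powr_mono2) auto
    then show "w R y \<le> g y" using g(2)[of y] unfolding w_def by (simp add: mult_left_le)
    show "0 \<le> w R y" using g(2)[of y] by (simp add: w_def)
  qed
  have w_meas[measurable]: "w R \<in> borel_measurable borel" for R
    unfolding w_def by measurable
  have w_int: "integrable lborel (w R)" if "0 < R" for R
    using w_bounds[OF that] g by (intro Bochner_Integration.integrable_bound[OF g(1)]) auto
  have lim: "(\<lambda>m. \<integral>y. w (real (Suc m)) y \<partial>lborel) \<longlonglongrightarrow> (\<integral>y. 0 \<partial>(lborel :: (real ^ 'd) measure))"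
  proof (rule integral_dominated_convergence[where w = g])
    show "AE y in lborel. (\<lambda>m. w (real (Suc m)) y) \<longlonglongrightarrow> 0"
    proof (rule AE_I2)
      fix y :: "real ^ 'd"
      have "(\<lambda>m. (norm y + 1) / real (Suc m)) \<longlonglongrightarrow> 0" by real_asymp
      then have "(\<lambda>m. min 1 ((norm y + 1) / real (Suc m))) \<longlonglongrightarrow> min 1 0"
        by (intro tendsto_min tendsto_const)
      then have "(\<lambda>m. min 1 ((norm y + 1) / real (Suc m)) powr q) \<longlonglongrightarrow> (min 1 0) powr q"
        using q by (intro tendsto_powr' tendsto_const) auto
      then show "(\<lambda>m. w (real (Suc m)) y) \<longlonglongrightarrow> 0"
        unfolding w_def using tendsto_mult_right_zero by (auto simp: tendsto_mult_right_zero)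
    qed
    show "AE y in lborel. norm (w (real (Suc m)) y) \<le> g y" for m
      using w_bounds[of "real (Suc m)"] by (intro AE_I2) simp
  qed (use g in auto)
  define M where "M = card {n :: int ^ 'd. norm (lattice_point n) \<le> (2 * ?d + 2) + ?d}"
  have "\<exists>m. \<kappa> * (2 * real M) * (\<integral>y. w (real (Suc m)) y \<partial>lborel) < \<eta>"
  proof -
    have "(\<lambda>m. \<kappa> * (2 * real M) * (\<integral>y. w (real (Suc m)) y \<partial>lborel)) \<longlonglongrightarrow> \<kappa> * (2 * real M) * 0"
      using lim by (intro tendsto_mult tendsto_const) simp
    then have "\<forall>\<^sub>F m in sequentially. \<kappa> * (2 * real M) * (\<integral>y. w (real (Suc m)) y \<partial>lborel) < \<eta>"
      using \<eta> by (intro order_tendstoD(2)) auto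
    then show ?thesis by (auto simp: eventually_sequentially)
  qed
  then obtain m where m: "\<kappa> * (2 * real M) * (\<integral>y. w (real (Suc m)) y \<partial>lborel) < \<eta>" by blast
  define R where "R = real (Suc m)"
  have R: "1 \<le> R" "0 < R" by (auto simp: R_def)
  define E where "E n = {y :: real ^ 'd. norm (lattice_point n) \<le> 2 * ?d + 1
      \<or> norm (y /\<^sub>R R - lattice_point n) \<le> 2 * ?d + 2}" for n
  have [measurable]: "E n \<in> sets borel" for n
    unfolding E_def by measurable
  define h where "h n y = indicator (E n) y * w R y" for n y
  have h: "integrable lborel (h n)" "0 \<le> h n y" for n y
    using integrable_mult_indicator[OF _ w_int[OF R(2)], of "E n"] w_bounds[OF R(2)]
    by (auto simp: h_def[abs_def])
  have profile_le: "commutator_profile q R H n x \<le> h n y" if xy: "dist x y < 1" for n x y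
  proof (cases "norm (lattice_point n) \<le> 2 * ?d + 1
       \<or> norm (x /\<^sub>R R - lattice_point n) \<le> 2 * ?d + 1")
    case True
    have "norm (y /\<^sub>R R - lattice_point n) \<le> norm (x /\<^sub>R R - lattice_point n) + norm ((y - x) /\<^sub>R R)"
      using norm_triangle_ineq[of "x /\<^sub>R R - lattice_point n" "(y - x) /\<^sub>R R"]
      by (simp add: scaleR_diff_right)
    moreover have "norm ((y - x) /\<^sub>R R) \<le> 1"
    proof -
      have "norm ((y - x) /\<^sub>R R) = norm (y - x) / R" using R by (simp add: divide_inverse mult.commute)
      also have "\<dots> \<le> 1" using xy R by (simp add: dist_norm norm_minus_commute)
      finally show ?thesis .
    qed
    ultimately have "y \<in> E n" using True by (auto simp: E_def)
    moreover have "\<bar>H x\<bar> powr q * min 1 (norm x / R) powr q \<le> w R y"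
      unfolding w_def
    proof (intro mult_mono powr_mono2 g(3)[OF xy])
      have "norm x \<le> norm y + 1"
        using xy norm_triangle_ineq2[of x y] by (simp add: dist_norm)
      then show "min 1 (norm x / R) \<le> min 1 ((norm y + 1) / R)"
        using R by (intro min.mono divide_right_mono) auto
    qed (use q R g in auto)
    ultimately show ?thesis using True by (simp add: commutator_profile_def h_def)
  next
    case False
    then show ?thesis using h(2) by (simp add: commutator_profile_def)
  qed
  define U where "U n = \<kappa> * (\<integral>y. h n y \<partial>lborel)" for n
  show ?thesis
  proof (rule that[OF R(1)])
    show "0 \<le> U n" for n unfolding U_def using \<kappa> h by (intro mult_nonneg_nonneg integral_nonneg) auto
    show "(\<Sum>r\<in>G. commutator_profile q R H n (l - r)) \<le> U n" if "finite G" "G \<subseteq> \<Gamma>" for n l G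
      unfolding U_def \<kappa>_def by (rule separated_difference_sums(1)[OF N(2) h profile_le that])
    show "(\<Sum>l\<in>F. commutator_profile q R H n (l - r)) \<le> U n" if "finite F" "F \<subseteq> \<Lambda>" for n r F
      unfolding U_def \<kappa>_def by (rule separated_difference_sums(2)[OF N(1) h profile_le that])
    show "(\<Sum>n\<in>F. U n) \<le> \<eta>" if F: "finite F" for F
    proof -
      have mult: "(\<Sum>n\<in>F. h n y) \<le> 2 * real M * w R y" for y
      proof -
        have "card {n\<in>F. y \<in> E n} \<le> card ({n\<in>F. norm (0 - lattice_point n) \<le> 2 * ?d + 2}
            \<union> {n\<in>F. norm (y /\<^sub>R R - lattice_point n) \<le> 2 * ?d + 2})"
          using F by (intro card_mono) (auto simp: E_def)
        also have "\<dots> \<le> M + M"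
          using card_lattice_points_near[OF F, of 0 "2 * ?d + 2"]
            card_lattice_points_near[OF F, of "y /\<^sub>R R" "2 * ?d + 2"]
          unfolding M_def by (intro order_trans[OF card_Un_le] add_mono)
        finally have "real (card {n\<in>F. y \<in> E n}) \<le> 2 * real M" by simp
        moreover have "(\<Sum>n\<in>F. indicator (E n) y :: real) = real (card {n\<in>F. y \<in> E n})"
          using F by (simp add: indicator_def sum.If_cases Int_def)
        ultimately show ?thesis
          unfolding h_def sum_distrib_right[symmetric] using w_bounds[OF R(2)]
          by (intro mult_right_mono) auto
      qed
      have "(\<Sum>n\<in>F. U n) = \<kappa> * (\<integral>y. (\<Sum>n\<in>F. h n y) \<partial>lborel)"
        unfolding U_def sum_distrib_left[symmetric] using h
        by (subst Bochner_Integration.integral_sum) auto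
      also have "\<dots> \<le> \<kappa> * (\<integral>y. 2 * real M * w R y \<partial>lborel)"
        using \<kappa> h mult w_int[OF R(2)] by (intro mult_left_mono integral_mono) auto
      also have "\<dots> \<le> \<eta>" using m by (simp add: R_def mult_ac)
      finally show ?thesis .
    qed
  qed
qed

section \<open>The localized estimate and the inverse matrix\<close>

lemma window_times_lp_space:
  assumes p: "0 < p" and u: "u \<in> lp_space p I"
  shows "(\<lambda>x. of_real (window R k x) * u x) \<in> lp_space p I"
    and "lp_norm p (\<lambda>x. of_real (window R k x) * u x) powr subadd_exp p \<le> lp_norm p u powr subadd_exp p"
proof -
  have le: "lp_le p UNIV (\<lambda>x. norm (of_real (window R k x) * u x)) (lp_norm p u powr subadd_exp p)"
    by (rule lp_le_mono[OF p lp_le_lp_norm[OF p u, of UNIV]])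
      (auto simp: norm_mult window_bounds mult_left_le_one_le)
  then show mem: "(\<lambda>x. of_real (window R k x) * u x) \<in> lp_space p I"
    using u by (auto simp: lp_space_eq_lp_le[OF p] intro!: exI[of _ "lp_norm p u powr subadd_exp p"])
  show "lp_norm p (\<lambda>x. of_real (window R k x) * u x) powr subadd_exp p \<le> lp_norm p u powr subadd_exp p"
    by (rule lp_norm_le[OF p mem powr_ge_zero le])
qed

text \<open>
  Apply the lower bound of \<open>A\<close> to \<open>\<phi>\<^sub>k c\<close> and write \<open>A \<phi>\<^sub>k c = \<phi>\<^sub>k A c + [A, \<phi>\<^sub>k] c\<close>. The commutator
  acts on the sharp cells of \<open>c\<close> by the block form of Schur's test; the part of \<open>c\<close> in the cell \<open>j\<close> is
  dominated by \<open>\<phi>\<^sub>j c\<close>.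
\<close>

lemma localized_estimate:
  fixes \<Lambda> \<Gamma> :: "(real ^ 'd) set" and R :: real and k :: "int ^ 'd" and p :: ennreal
  defines "N \<equiv> \<lambda>c k. lp_norm p (\<lambda>x. of_real (window R k x) * c x) powr subadd_exp p"
  assumes q: "0 < q" "q \<le> 1" "ennreal q \<le> p"
    and \<Lambda>: "relatively_separated \<Lambda>" and \<Gamma>: "relatively_separated \<Gamma>"
    and A: "A \<in> conv_dominated q \<Lambda> \<Gamma>"
    and H: "\<And>l r. l \<in> \<Lambda> \<Longrightarrow> r \<in> \<Gamma> \<Longrightarrow> norm (A l r) \<le> H (l - r)"
    and R: "1 \<le> R" and U: "\<And>n. 0 \<le> U n" "\<And>F. finite F \<Longrightarrow> (\<Sum>n\<in>F. U n) \<le> \<eta>"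
    and U_rows: "\<And>n l G. finite G \<Longrightarrow> G \<subseteq> \<Gamma> \<Longrightarrow> (\<Sum>r\<in>G. commutator_profile q R H n (l - r)) \<le> U n"
    and U_cols: "\<And>n r F. finite F \<Longrightarrow> F \<subseteq> \<Lambda> \<Longrightarrow> (\<Sum>l\<in>F. commutator_profile q R H n (l - r)) \<le> U n"
    and inj: "\<And>c. c \<in> lp_space p \<Gamma> \<Longrightarrow> lp_norm p c \<le> K * lp_norm p (matrix_operator \<Lambda> \<Gamma> A c)" and K: "0 \<le> K"
    and c: "c \<in> lp_space p \<Gamma>"
  shows "N c k \<le> lp_norm p c powr subadd_exp p"
    and "N c k \<le> 2 * K powr subadd_exp p *
      (N (matrix_operator \<Lambda> \<Gamma> A c) k + (\<Sum>\<^sub>\<infinity>j. U (k - j) powr (subadd_exp p / q) * N c j))"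
proof -
  let ?t = "subadd_exp p"
  have p: "0 < p" and qt: "q \<le> ?t" using subadd_exp_ge[OF q] by auto
  have t: "0 < ?t" using p by (rule subadd_exp_pos)
  define d where "d = matrix_operator \<Lambda> \<Gamma> A c"
  have d: "d \<in> lp_space p \<Lambda>" unfolding d_def by (rule conv_dominated_operator(2)[OF q \<Lambda> \<Gamma> A c])
  show "N c k \<le> lp_norm p c powr ?t" for k using window_times_lp_space[OF p c, of R] by (simp add: N_def)
  note N_le = this
  have N_nonneg: "0 \<le> N c j" for j by (simp add: N_def)
  have U_sum: "(\<lambda>j. U (k - j) powr (?t / q) * N c j) summable_on UNIV"
  proof (rule summable_onI_nonneg)
    fix F :: "(int ^ 'd) set" assume F: "finite F"
    have "(\<Sum>j\<in>F. U (k - j) powr (?t / q)) = (\<Sum>n\<in>(\<lambda>j. k - j) ` F. U n powr (?t / q))"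
      by (subst sum.reindex) (auto simp: inj_on_def)
    also have "\<dots> \<le> (\<Sum>n\<in>(\<lambda>j. k - j) ` F. U n) powr (?t / q)"
      using F U q qt by (intro sum_powr_le_powr_sum) auto
    also have "\<dots> \<le> \<eta> powr (?t / q)"
      using F U q t by (intro powr_mono2 sum_nonneg) auto
    finally have *: "(\<Sum>j\<in>F. U (k - j) powr (?t / q)) \<le> \<eta> powr (?t / q)" .
    have "(\<Sum>j\<in>F. U (k - j) powr (?t / q) * N c j) \<le> (\<Sum>j\<in>F. U (k - j) powr (?t / q)) * lp_norm p c powr ?t"
      unfolding sum_distrib_right using N_le by (intro sum_mono mult_left_mono) auto
    also have "\<dots> \<le> \<eta> powr (?t / q) * lp_norm p c powr ?t"
      using * by (intro mult_right_mono) auto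
    finally show "(\<Sum>j\<in>F. U (k - j) powr (?t / q) * N c j) \<le> \<eta> powr (?t / q) * lp_norm p c powr ?t" .
  qed (simp add: N_nonneg)
  define m where "m l r = norm (A l r) * \<bar>window R k r - window R k l\<bar>" for l r
  have m_profile: "m l r powr q \<le> commutator_profile q R H (k - vec_floor (r /\<^sub>R R)) (l - r)"
    if "l \<in> \<Lambda>" "r \<in> \<Gamma>" for l r
    unfolding m_def using q R H[OF that] by (intro commutator_entry_le_profile) auto
  let ?b = "\<lambda>r. vec_floor (r /\<^sub>R R)"
  have rows: "(\<Sum>r\<in>G. m l r powr ?t) \<le> U (k - j) powr (?t / q)"
    if "l \<in> \<Lambda>" "finite G" "G \<subseteq> {r\<in>\<Gamma>. ?b r = j}" for l j G
  proof (rule sum_powr_exponent_mono)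
    have "(\<Sum>r\<in>G. m l r powr q) \<le> (\<Sum>r\<in>G. commutator_profile q R H (k - j) (l - r))"
      using that by (intro sum_mono order_trans[OF m_profile]) auto
    also have "\<dots> \<le> U (k - j)" using that by (intro U_rows) auto
    finally show "(\<Sum>r\<in>G. m l r powr q) \<le> U (k - j)" .
  qed (use that q qt in \<open>auto simp: m_def\<close>)
  have cols: "(\<Sum>l\<in>F. m l r powr ?t) \<le> U (k - ?b r) powr (?t / q)"
    if "r \<in> \<Gamma>" "finite F" "F \<subseteq> \<Lambda>" for r F
  proof (rule sum_powr_exponent_mono)
    have "(\<Sum>l\<in>F. m l r powr q) \<le> (\<Sum>l\<in>F. commutator_profile q R H (k - ?b r) (l - r))"
      using that by (intro sum_mono m_profile) auto
    also have "\<dots> \<le> U (k - ?b r)" using that by (intro U_cols) auto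
    finally show "(\<Sum>l\<in>F. m l r powr q) \<le> U (k - ?b r)" .
  qed (use that q qt in \<open>auto simp: m_def\<close>)
  have blocks: "lp_le p {r\<in>\<Gamma>. ?b r = j} (\<lambda>r. norm (c r)) (N c j)" for j
  proof (rule lp_le_mono[OF p])
    show "lp_le p UNIV (\<lambda>r. norm (of_real (window R j r) * c r)) (N c j)"
      unfolding N_def using lp_le_lp_norm[OF p] window_times_lp_space[OF p c, of R] by blast
    show "norm (c r) \<le> norm (of_real (window R j r) * c r)" if "r \<in> {r\<in>\<Gamma>. ?b r = j}" for r
      using that window_eq_1[of R r] by auto
  qed (auto simp: N_nonneg)
  define T where "T = (\<Sum>\<^sub>\<infinity>j. U (k - j) powr (?t / q) * N c j)"
  have T: "0 \<le> T" unfolding T_def by (intro infsum_nonneg) (simp add: N_nonneg)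
  have m_nonneg: "0 \<le> m l r" for l r by (simp add: m_def)
  note bs = block_schur[where p = p and I = \<Lambda> and J = \<Gamma> and m = m and x = "\<lambda>r. norm (c r)" and b = ?b
      and V = "\<lambda>j. U (k - j) powr (?t / q)" and N = "N c"]
  have m_summable: "(\<lambda>r. m l r * norm (c r)) summable_on \<Gamma>" if "l \<in> \<Lambda>" for l
    by (rule bs(1)[OF p m_nonneg norm_ge_zero rows cols powr_ge_zero N_nonneg blocks U_sum that])
  have m_le: "lp_le p \<Lambda> (\<lambda>l. \<Sum>\<^sub>\<infinity>r\<in>\<Gamma>. m l r * norm (c r)) T"
    unfolding T_def
    by (rule bs(2)[OF p m_nonneg norm_ge_zero rows cols powr_ge_zero N_nonneg blocks U_sum])
  define u where "u = (\<lambda>x. of_real (window R k x) * c x)"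
  have u: "u \<in> lp_space p \<Gamma>" using window_times_lp_space[OF p c, of R] by (simp add: u_def)
  have Au: "matrix_operator \<Lambda> \<Gamma> A u \<in> lp_space p \<Lambda>" by (rule conv_dominated_operator(2)[OF q \<Lambda> \<Gamma> A u])
  have pointwise: "norm (matrix_operator \<Lambda> \<Gamma> A u l)
      \<le> norm (of_real (window R k l) * d l) + (\<Sum>\<^sub>\<infinity>r\<in>\<Gamma>. m l r * norm (c r))" if l: "l \<in> \<Lambda>" for l
  proof -
    have abs_c: "(\<lambda>r. norm (A l r * c r)) summable_on \<Gamma>"
      using conv_dominated_operator(1)[OF q \<Lambda> \<Gamma> A c l] by (simp add: norm_mult)
    have sum_c: "(\<lambda>r. A l r * c r) summable_on \<Gamma>" by (rule abs_summable_summable[OF abs_c])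
    have abs_u: "(\<lambda>r. norm (A l r * u r)) summable_on \<Gamma>"
      using conv_dominated_operator(1)[OF q \<Lambda> \<Gamma> A u l] by (simp add: norm_mult)
    have sum_u: "(\<lambda>r. A l r * u r) summable_on \<Gamma>" by (rule abs_summable_summable[OF abs_u])
    have norm_eq: "norm (A l r * u r - of_real (window R k l) * (A l r * c r)) = m l r * norm (c r)" for r
    proof -
      have "A l r * u r - of_real (window R k l) * (A l r * c r)
          = A l r * of_real (window R k r - window R k l) * c r"
        by (simp add: u_def algebra_simps)
      then show ?thesis by (simp add: norm_mult m_def del: of_real_diff)
    qed
    have "matrix_operator \<Lambda> \<Gamma> A u l - of_real (window R k l) * d l
        = (\<Sum>\<^sub>\<infinity>r\<in>\<Gamma>. A l r * u r - of_real (window R k l) * (A l r * c r))"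
      using l infsum_add[OF sum_u summable_on_cmult_right[OF sum_c, of "- of_real (window R k l)"]]
      by (simp add: matrix_operator_def d_def infsum_cmult_right' infsum_uminus)
    also have "norm \<dots> \<le> (\<Sum>\<^sub>\<infinity>r\<in>\<Gamma>. m l r * norm (c r))"
      using norm_infsum_bound[of "\<lambda>r. A l r * u r - of_real (window R k l) * (A l r * c r)" \<Gamma>] m_summable[OF l]
      by (simp add: norm_eq)
    finally show ?thesis using norm_triangle_sub[of "matrix_operator \<Lambda> \<Gamma> A u l" "of_real (window R k l) * d l"] by simp
  qed
  have "lp_le p \<Lambda> (\<lambda>l. norm (of_real (window R k l) * d l) + (\<Sum>\<^sub>\<infinity>r\<in>\<Gamma>. m l r * norm (c r))) (2 * (N d k + T))"
  proof (rule lp_le_add[OF p])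
    show "lp_le p \<Lambda> (\<lambda>l. norm (of_real (window R k l) * d l)) (N d k)"
      unfolding N_def using lp_le_lp_norm[OF p] window_times_lp_space[OF p d, of R] by blast
    show "lp_le p \<Lambda> (\<lambda>l. \<Sum>\<^sub>\<infinity>r\<in>\<Gamma>. m l r * norm (c r)) T" by (rule m_le)
  qed (auto simp: N_def T m_nonneg intro!: infsum_nonneg)
  then have "lp_le p \<Lambda> (\<lambda>l. norm (matrix_operator \<Lambda> \<Gamma> A u l)) (2 * (N d k + T))"
    by (rule lp_le_mono[OF p]) (use T pointwise in \<open>auto simp: N_def\<close>)
  then have "lp_norm p (matrix_operator \<Lambda> \<Gamma> A u) powr ?t \<le> 2 * (N d k + T)"
    using T by (intro lp_norm_le[OF p Au] lp_le_UNIV[OF p, of _ \<Lambda>]) (auto simp: N_def matrix_operator_def)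
  moreover have "lp_norm p u powr ?t \<le> K powr ?t * lp_norm p (matrix_operator \<Lambda> \<Gamma> A u) powr ?t"
  proof -
    have "lp_norm p u powr ?t \<le> (K * lp_norm p (matrix_operator \<Lambda> \<Gamma> A u)) powr ?t"
      using inj[OF u] lp_norm_nonneg[OF u] t by (intro powr_mono2) auto
    then show ?thesis by (simp add: powr_mult)
  qed
  moreover have "N c k = lp_norm p u powr ?t" by (simp add: N_def u_def)
  ultimately have "N c k \<le> K powr ?t * (2 * (N d k + T))"
    by (smt (verit) mult_left_mono powr_ge_zero)
  then have "N c k \<le> 2 * K powr ?t * (N d k + T)" by (simp only: mult_ac)
  then show "N c k \<le> 2 * K powr ?t * (N (matrix_operator \<Lambda> \<Gamma> A c) k + (\<Sum>\<^sub>\<infinity>j. U (k - j) powr (?t / q) * N c j))"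
    by (simp only: d_def T_def)
qed

text \<open>
  For \<open>c = S (unit_seq l)\<close> the localized norms satisfy a convolution inequality whose source is
  concentrated at the cell of \<open>l\<close>. The scale \<open>R\<close> is fixed by \<open>A\<close> and the norm of \<open>S\<close> alone, so one majorant \<open>W\<close> serves
  all columns. As \<open>\<bar>c r\<bar> powr t\<close> is bounded by \<open>W\<close>, where \<open>t = subadd_exp p\<close>, the envelope is built from the
  \<open>1 / t\<close>-th power of \<open>W\<close>, which is \<open>q\<close>-summable because \<open>W\<close> is \<open>q / t\<close>-summable.
\<close>

lemma inverse_columns_dominated:
  fixes \<Lambda> \<Gamma> :: "(real ^ 'd) set"
  assumes q: "0 < q" "q \<le> 1" "ennreal q \<le> p"
    and \<Lambda>: "relatively_separated \<Lambda>" and \<Gamma>: "relatively_separated \<Gamma>"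
    and A: "A \<in> conv_dominated q \<Lambda> \<Gamma>"
    and inv: "lp_inverse_operators p \<Gamma> \<Lambda> (matrix_operator \<Lambda> \<Gamma> A) S"
  shows "(\<lambda>r l. S (unit_seq l) r) \<in> conv_dominated q \<Gamma> \<Lambda>"
proof -
  let ?t = "subadd_exp p" and ?d = "cell_diameter TYPE('d)"
  have p: "0 < p" and qt: "q \<le> ?t" using subadd_exp_ge[OF q] by auto
  have t: "0 < ?t" using p by (rule subadd_exp_pos)
  obtain H where H: "H \<in> wiener_amalgam q" "\<And>l r. l \<in> \<Lambda> \<Longrightarrow> r \<in> \<Gamma> \<Longrightarrow> norm (A l r) \<le> H (l - r)"
    using A by (auto simp: conv_dominated_def)
  have S_space: "S d \<in> lp_space p \<Gamma>" and S_inv: "matrix_operator \<Lambda> \<Gamma> A (S d) = d" if "d \<in> lp_space p \<Lambda>" for d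
    using inv that by (auto simp: lp_inverse_operators_def lp_bounded_operator_def)
  obtain K0 where K0: "\<And>d. d \<in> lp_space p \<Lambda> \<Longrightarrow> lp_norm p (S d) \<le> K0 * lp_norm p d"
    using inv unfolding lp_inverse_operators_def lp_bounded_operator_def by metis
  define K where "K = max 1 K0"
  have K: "1 \<le> K" by (simp add: K_def)
  have inj: "lp_norm p c \<le> K * lp_norm p (matrix_operator \<Lambda> \<Gamma> A c)" if c: "c \<in> lp_space p \<Gamma>" for c
  proof -
    let ?Ac = "matrix_operator \<Lambda> \<Gamma> A c"
    have Ac: "?Ac \<in> lp_space p \<Lambda>" and "S ?Ac = c"
      using inv c by (auto simp: lp_inverse_operators_def lp_bounded_operator_def)
    then have "lp_norm p c \<le> K0 * lp_norm p ?Ac" using K0[OF Ac] by simp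
    also have "\<dots> \<le> K * lp_norm p ?Ac"
      using lp_norm_nonneg[OF Ac] by (intro mult_right_mono) (auto simp: K_def)
    finally show ?thesis .
  qed
  define s where "s = q / ?t"
  have s: "0 < s" "s \<le> 1" using q t qt by (auto simp: s_def)
  define c1 where "c1 = 2 * K powr ?t"
  have c1: "0 < c1" using K by (simp add: c1_def)
  \<comment> \<open>This bound on \<open>\<Sum>n. U n\<close> makes \<open>\<Sum>n. V n powr s \<le> 1 / 2\<close> for the rescaled kernel \<open>V\<close> below.\<close>
  define \<eta> where "\<eta> = 1 / (2 * c1 powr s)"
  have \<eta>: "0 < \<eta>" using c1 by (simp add: \<eta>_def)
  obtain R U where R: "1 \<le> R" and U: "\<And>n. 0 \<le> U n" "\<And>F. finite F \<Longrightarrow> (\<Sum>n\<in>F. U n) \<le> \<eta>"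
    "\<And>n l G. finite G \<Longrightarrow> G \<subseteq> \<Gamma> \<Longrightarrow> (\<Sum>r\<in>G. commutator_profile q R H n (l - r)) \<le> U n"
    "\<And>n r F. finite F \<Longrightarrow> F \<subseteq> \<Lambda> \<Longrightarrow> (\<Sum>l\<in>F. commutator_profile q R H n (l - r)) \<le> U n"
    using commutator_kernel[OF q(1) \<Lambda> \<Gamma> H(1) \<eta>] by metis
  define V where "V n = c1 * U n powr (?t / q)" for n
  have V_pow: "V n powr s = c1 powr s * U n" for n
    using U(1)[of n] q t by (simp add: V_def powr_mult powr_powr s_def)
  \<comment> \<open>The offsets from the cell of \<open>l\<close> at which a window can be nonzero at \<open>l\<close>.\<close>
  define near where "near = {n :: int ^ 'd. norm (lattice_point n) \<le> 2 * ?d + 1}"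
  have near_fin: "finite near" unfolding near_def by (rule finite_lattice_points_near_0)
  define g where "g n = c1 * of_bool (n \<in> near)" for n
  have g_sum: "(\<Sum>n\<in>F. g n powr s) \<le> c1 powr s * real (card near)" if "finite F" for F
  proof -
    have "(\<Sum>n\<in>F. g n powr s) = (\<Sum>n\<in>F \<inter> near. c1 powr s)"
      using that by (intro sum.mono_neutral_cong_right) (auto simp: g_def)
    also have "\<dots> \<le> c1 powr s * real (card near)"
      using near_fin by (simp add: mult.commute[of _ "c1 powr s"] mult_left_mono card_mono)
    finally show ?thesis .
  qed
  have V_nonneg: "0 \<le> V n" and g_nonneg: "0 \<le> g n" for n using c1 by (auto simp: V_def g_def)
  have V_sum: "(\<Sum>n\<in>F. V n powr s) \<le> 1 / 2" if "finite F" for F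
  proof -
    have "(\<Sum>n\<in>F. V n powr s) = c1 powr s * (\<Sum>n\<in>F. U n)" by (simp add: V_pow sum_distrib_left)
    also have "\<dots> \<le> c1 powr s * \<eta>" using U(2)[OF that] by (intro mult_left_mono) auto
    also have "\<dots> = 1 / 2" using c1 by (simp add: \<eta>_def)
    finally show ?thesis .
  qed
  have "\<exists>W. (\<forall>n. 0 \<le> W n)
      \<and> (\<forall>F. finite F \<longrightarrow> (\<Sum>n\<in>F. W n powr s) \<le> 2 * (c1 powr s * real (card near)))
      \<and> (\<forall>N M k0. (\<forall>k. 0 \<le> N k \<and> N k \<le> M) \<longrightarrow>
         (\<forall>k. N k \<le> g (k - k0) + (\<Sum>\<^sub>\<infinity>j. V (k - j) * N j)) \<longrightarrow> (\<forall>k. N k \<le> W (k - k0)))"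
    by (rule convolution_majorant[OF s V_nonneg V_sum g_nonneg g_sum])
  then obtain W where W: "\<forall>n. 0 \<le> W n"
    "\<forall>F. finite F \<longrightarrow> (\<Sum>n\<in>F. W n powr s) \<le> 2 * (c1 powr s * real (card near))"
    "\<forall>N M k0. (\<forall>k. 0 \<le> N k \<and> N k \<le> M) \<longrightarrow>
       (\<forall>k. N k \<le> g (k - k0) + (\<Sum>\<^sub>\<infinity>j. V (k - j) * N j)) \<longrightarrow> (\<forall>k. N k \<le> W (k - k0))"
    by (elim exE conjE)
  define w where "w n = W n powr (1 / ?t)" for n
  have "w n powr q = W n powr s" for n using W(1) by (simp add: w_def powr_powr s_def)
  then have w_sum: "finite F \<Longrightarrow> (\<Sum>n\<in>F. w n powr q) \<le> 2 * (c1 powr s * real (card near))" for F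
    using W(2) by simp
  have R0: "0 < R" using R by simp
  have w_nonneg: "0 \<le> w n" for n by (simp add: w_def)
  obtain H' where H': "H' \<in> wiener_amalgam q"
    "\<And>l r. w (vec_floor (l /\<^sub>R R) - vec_floor (r /\<^sub>R R)) \<le> H' (l - r)"
    using lattice_envelope[OF q(1) R0 w_nonneg w_sum] by metis
  have "norm (S (unit_seq l) r) \<le> H' (r - l)" if r: "r \<in> \<Gamma>" and l: "l \<in> \<Lambda>" for r l
  proof -
    define c where "c = S (unit_seq l)"
    have e: "unit_seq l \<in> lp_space p \<Lambda>" using p l by (rule unit_seq_lp_space)
    have c: "c \<in> lp_space p \<Gamma>" and Ac: "matrix_operator \<Lambda> \<Gamma> A c = unit_seq l"
      using S_space[OF e] S_inv[OF e] by (auto simp: c_def)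
    define N where "N c k = lp_norm p (\<lambda>x. of_real (window R k x) * c x) powr ?t"
      for c :: "real ^ 'd \<Rightarrow> complex" and k
    note le = localized_estimate[OF q \<Lambda> \<Gamma> A H(2) R U inj _ c, folded N_def, unfolded Ac]
    let ?j0 = "vec_floor (l /\<^sub>R R)"
    have source: "N (unit_seq l) k \<le> of_bool (k - ?j0 \<in> near)" for k
    proof -
      have eq: "(\<lambda>x. of_real (window R k x) * unit_seq l x) = (\<lambda>x. of_real (window R k l) * unit_seq l x)"
        by (auto simp: unit_seq_def)
      have far: "window R k l = 0" if "k - ?j0 \<notin> near"
      proof (rule ccontr)
        assume "window R k l \<noteq> 0"
        then have "norm (l /\<^sub>R R - lattice_point k) < ?d + 1" by (rule window_nonzero)
        moreover have "lattice_point (k - ?j0) = (l /\<^sub>R R - lattice_point ?j0) - (l /\<^sub>R R - lattice_point k)"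
          by (simp add: lattice_point_diff)
        ultimately have "norm (lattice_point (k - ?j0)) \<le> 2 * ?d + 1"
          using norm_triangle_ineq4[of "l /\<^sub>R R - lattice_point ?j0" "l /\<^sub>R R - lattice_point k"]
            norm_diff_vec_floor[of "l /\<^sub>R R"] by simp
        with that show False by (simp add: near_def)
      qed
      have "window R k l powr ?t \<le> 1 powr ?t" using t by (intro powr_mono2) (auto simp: window_bounds)
      then have bound: "norm (complex_of_real (window R k l)) powr ?t \<le> of_bool (k - ?j0 \<in> near)"
        using far by (cases "k - ?j0 \<in> near") (auto simp: window_bounds)
      have le': "lp_le p UNIV (\<lambda>x. norm (complex_of_real (window R k l) * unit_seq l x)) (of_bool (k - ?j0 \<in> near))"
        using p bound by (intro unit_seq_lp_le) auto
      have "(\<lambda>x. complex_of_real (window R k l) * unit_seq l x) \<in> lp_space p UNIV"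
        using le' by (intro lp_space_I[OF p]) auto
      then show ?thesis
        unfolding N_def eq using le' by (intro lp_norm_le[OF p]) auto
    qed
    have N_le: "N c k \<le> W (k - ?j0)" for k
    proof (rule W(3)[rule_format])
      show "0 \<le> N c k \<and> N c k \<le> lp_norm p c powr ?t" for k using le(1)[of k] K by (simp add: N_def)
      show "N c k \<le> g (k - ?j0) + (\<Sum>\<^sub>\<infinity>j. V (k - j) * N c j)" for k
      proof -
        have "N c k \<le> c1 * (N (unit_seq l) k + (\<Sum>\<^sub>\<infinity>j. U (k - j) powr (?t / q) * N c j))"
          using le(2)[of k] K by (simp add: c1_def)
        also have "\<dots> \<le> c1 * (of_bool (k - ?j0 \<in> near) + (\<Sum>\<^sub>\<infinity>j. U (k - j) powr (?t / q) * N c j))"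
          using source[of k] c1 by (intro mult_left_mono add_right_mono) auto
        also have "\<dots> = g (k - ?j0) + (\<Sum>\<^sub>\<infinity>j. V (k - j) * N c j)"
          by (simp add: g_def V_def distrib_left mult.assoc infsum_cmult_right')
        finally show ?thesis .
      qed
    qed
    let ?k = "vec_floor (r /\<^sub>R R)"
    have "norm (c r) powr ?t \<le> N c ?k"
    proof -
      have "lp_le p UNIV (\<lambda>x. norm (of_real (window R ?k x) * c x)) (N c ?k)"
        unfolding N_def
        by (rule lp_le_lp_norm[OF p window_times_lp_space(1)[OF p c]])
      from lp_le_entry[OF p this, of r] show ?thesis
        by (simp add: N_def window_eq_1)
    qed
    also have "\<dots> \<le> W (?k - ?j0)" by (rule N_le)
    finally have "(norm (c r) powr ?t) powr (1 / ?t) \<le> w (?k - ?j0)"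
      unfolding w_def using t by (intro powr_mono2) auto
    then have "norm (c r) \<le> w (?k - ?j0)" using t by (simp add: powr_powr)
    also have "\<dots> \<le> H' (r - l)" by (rule H'(2))
    finally show ?thesis by (simp add: c_def)
  qed
  then show ?thesis using H'(1) by (auto simp: conv_dominated_def)
qed

theorem theorem3p14:
  fixes \<Lambda> \<Gamma> :: "(real ^ 'd) set" and A :: "real ^ 'd \<Rightarrow> real ^ 'd \<Rightarrow> complex"
    and p0 :: real and p :: ennreal
  assumes "0 < p0" and "p0 \<le> 1"
    and "relatively_separated \<Lambda>" and "relatively_separated \<Gamma>"
    and "A \<in> conv_dominated p0 \<Lambda> \<Gamma>"
    and "ennreal p0 \<le> p"
    and "lp_invertible p \<Gamma> \<Lambda> (matrix_operator \<Lambda> \<Gamma> A)"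
  shows "\<exists>B \<in> conv_dominated p0 \<Gamma> \<Lambda>.
           lp_inverse_operators p \<Gamma> \<Lambda> (matrix_operator \<Lambda> \<Gamma> A) (matrix_operator \<Gamma> \<Lambda> B)"
proof -
  note q = assms(1,2,6) and sep = assms(3,4) and A = assms(5)
  have p: "0 < p" using subadd_exp_ge[OF q] by auto
  obtain S where S: "lp_inverse_operators p \<Gamma> \<Lambda> (matrix_operator \<Lambda> \<Gamma> A) S"
    using assms(7) by (auto simp: lp_invertible_def)
  then have SA: "\<And>c. c \<in> lp_space p \<Gamma> \<Longrightarrow> S (matrix_operator \<Lambda> \<Gamma> A c) = c"
    and AS: "\<And>d. d \<in> lp_space p \<Lambda> \<Longrightarrow> matrix_operator \<Lambda> \<Gamma> A (S d) = d"
    by (auto simp: lp_inverse_operators_def)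
  define B where "B r l = S (unit_seq l) r" for r l
  have B: "B \<in> conv_dominated p0 \<Gamma> \<Lambda>"
    using inverse_columns_dominated[OF q sep A S] by (simp add: B_def[abs_def])
  \<comment> \<open>The columns of \<open>B\<close> solve \<open>A c = e\<close>, so the matrix product \<open>A B\<close> is the identity.\<close>
  have AB: "(\<Sum>\<^sub>\<infinity>r\<in>\<Gamma>. A l r * B r l') = unit_seq l' l" if "l \<in> \<Lambda>" "l' \<in> \<Lambda>" for l l'
    using AS[OF unit_seq_lp_space[OF p that(2)]] that
    by (auto simp: matrix_operator_def B_def dest: fun_cong[of _ _ l])
  have eq: "matrix_operator \<Gamma> \<Lambda> B d = S d" if d: "d \<in> lp_space p \<Lambda>" for d
  proof -
    let ?u = "matrix_operator \<Gamma> \<Lambda> B d"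
    have u: "?u \<in> lp_space p \<Gamma>" by (rule conv_dominated_operator(2)[OF q sep(2,1) B d])
    have "matrix_operator \<Lambda> \<Gamma> A ?u l = d l" for l
    proof (cases "l \<in> \<Lambda>")
      case True
      have "matrix_operator \<Lambda> \<Gamma> A ?u l = (\<Sum>\<^sub>\<infinity>l'\<in>\<Lambda>. (\<Sum>\<^sub>\<infinity>r\<in>\<Gamma>. A l r * B r l') * d l')"
        by (rule matrix_operator_product[OF q sep A B d True])
      also have "\<dots> = (\<Sum>\<^sub>\<infinity>l'\<in>\<Lambda>. unit_seq l' l * d l')"
        using AB True by (intro infsum_cong) simp
      also have "\<dots> = (\<Sum>\<^sub>\<infinity>l'\<in>{l}. d l')"
        using True by (intro infsum_cong_neutral) (auto simp: unit_seq_def)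
      also have "\<dots> = d l" by simp
      finally show ?thesis .
    next
      case False
      then show ?thesis using d by (simp add: matrix_operator_def lp_space_def)
    qed
    then have "matrix_operator \<Lambda> \<Gamma> A ?u = d" by auto
    then show ?thesis using SA[OF u] by simp
  qed
  have add: "(\<lambda>i. c i + d i) \<in> lp_space p \<Lambda>" if "c \<in> lp_space p \<Lambda>" "d \<in> lp_space p \<Lambda>" for c d
    using that by (rule lp_space_add[OF p])
  have scale: "(\<lambda>i. z * c i) \<in> lp_space p \<Lambda>" if "c \<in> lp_space p \<Lambda>" for c z
    using that by (rule lp_space_scale)
  have "lp_inverse_operators p \<Gamma> \<Lambda> (matrix_operator \<Lambda> \<Gamma> A) (matrix_operator \<Gamma> \<Lambda> B)"
    using S eq add scale unfolding lp_inverse_operators_def lp_bounded_operator_def by simp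
  with B show ?thesis by blast
qed

end
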